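(* Let $\nu>2$ and let $(\Theta_{i1},\Theta_{i2})$, $i=1,2,\dots$, be i.i.d., where $\Theta_{i1}=(\Theta_{i1}^x,\Theta_{i1}^y)$ is bivariate normal with means $\mu_x,\mu_y$, variances $\sigma_x^2,\sigma_y^2$ and correlation $\rho$, $\Theta_{i2}=(\Theta_{i2}^x,\Theta_{i2}^y,\Theta_{i2}^{xy})$ has the bivariate Wishart distribution with $\nu$ degrees of freedom and parameters $\gamma_1,\gamma_2,\gamma_3$, and $\Theta_{i1}$ and $\Theta_{i2}$ are independent. Put $\sigma_{xy}=\rho\sigma_x\sigma_y$ and let $\hat\sigma_x^2,\hat\sigma_y^2,\hat\sigma_{xy},\hat\gamma_1,\hat\gamma_2,\hat\gamma_3$ be the maximum likelihood estimators based on $i=1,\dots,n$ given in the context. Then, as $n\to\infty$, with $\overset{D}{\longrightarrow}$ denoting convergence in distribution: (a) $\sqrt n(\hat\sigma_x^2-\sigma_x^2)\overset{D}{\longrightarrow}N(0,2\sigma_x^4)$, $\sqrt n(\hat\sigma_y^2-\sigma_y^2)\overset{D}{\longrightarrow}N(0,2\sigma_y^4)$, and $\sqrt n(\hat\sigma_{xy}-\sigma_{xy})\overset{D}{\longrightarrow}N\big(0,(1+\rho^2)\sigma_x^2\sigma_y^2\big)$; (b) $\sqrt{\nu n}(\hat\gamma_1-\gamma_1)\overset{D}{\longrightarrow}N(0,2\gamma_1^2)$, $\sqrt{\nu n}(\hat\gamma_2-\gamma_2)\overset{D}{\longrightarrow}N(0,2\gamma_2^2)$, and $\sqrt{\nu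 n}(\hat\gamma_3-\gamma_3)\overset{D}{\longrightarrow}N(0,\gamma_1\gamma_2+\gamma_3^2)$.
   Context: Parameters satisfy $\mu_x,\mu_y\in\mathbb{R}$, $\sigma_x,\sigma_y>0$, $|\rho|<1$, $\gamma_1,\gamma_2>0$, $\gamma_1\gamma_2>\gamma_3^2$. $N(m,v)$ is the normal distribution with mean $m$ and variance $v$. The bivariate Wishart distribution with $\nu$ degrees of freedom and parameters $\gamma_1,\gamma_2,\gamma_3$ is the law of $(s,t,r)$ such that $\begin{pmatrix}s&r\\ r&t\end{pmatrix}$ is Wishart distributed with $\nu$ degrees of freedom and scale matrix $\begin{pmatrix}\gamma_1&\gamma_3\\ \gamma_3&\gamma_2\end{pmatrix}$, i.e. with density on $\{s,t>0,\ r^2<st\}$ $$\frac{(\gamma_1\gamma_2-\gamma_3^2)^{-\nu/2}}{2^\nu\sqrt{\pi}\,\Gamma(\frac{\nu}{2})\Gamma(\frac{\nu-1}{2})}(st-r^2)^{\frac{\nu-3}{2}}\exp\left\{-\frac{\gamma_1\gamma_2}{2(\gamma_1\gamma_2-\gamma_3^2)}\left(\frac{s}{\gamma_1}+\frac{t}{\gamma_2}-\frac{2\gamma_3 r}{\gamma_1\gamma_2}\right)\right\}.$$ The estimators are $\hat\mu_x=\frac1n\sum_{i=1}^n\Theta_{i1}^x$, $\hat\mu_y=\frac1n\sum_{i=1}^n\Theta_{i1}^y$, $\hat\sigma_x^2=\frac1n\sum_{i=1}^n(\Theta_{i1}^x-\hat\mu_x)^2$, $\hat\sigma_y^2=\frac1n\sum_{i=1}^n(\Theta_{i1}^y-\hat\mu_y)^2$,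 $\hat\sigma_{xy}=\frac1n\sum_{i=1}^n(\Theta_{i1}^y-\hat\mu_y)(\Theta_{i1}^x-\hat\mu_x)$, $\hat\gamma_1=\frac1{n\nu}\sum_{i=1}^n\Theta_{i2}^x$, $\hat\gamma_2=\frac1{n\nu}\sum_{i=1}^n\Theta_{i2}^y$, $\hat\gamma_3=\frac1{n\nu}\sum_{i=1}^n\Theta_{i2}^{xy}$. *)

theory Defs
  imports "HOL-Probability.Probability"
begin

definition bivariate_normal_density ::
    "real \<Rightarrow> real \<Rightarrow> real \<Rightarrow> real \<Rightarrow> real \<Rightarrow> real \<times> real \<Rightarrow> real" where
  "bivariate_normal_density \<mu>x \<mu>y \<sigma>x \<sigma>y \<rho> = (\<lambda>(x, y).
     1 / (2 * pi * \<sigma>x * \<sigma>y * sqrt (1 - \<rho>\<^sup>2)) *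
     exp (- 1 / (2 * (1 - \<rho>\<^sup>2)) *
       (((x - \<mu>x) / \<sigma>x)\<^sup>2 - 2 * \<rho> * ((x - \<mu>x) / \<sigma>x) * ((y - \<mu>y) / \<sigma>y) + ((y - \<mu>y) / \<sigma>y)\<^sup>2)))"

text \<open>
  The argument is the triple \<open>(s, t, r)\<close>: the two diagonal entries of the random matrix come
  first, the off-diagonal entry last. The number of degrees of freedom is a real number.
\<close>

definition bivariate_wishart_density ::
    "real \<Rightarrow> real \<Rightarrow> real \<Rightarrow> real \<Rightarrow> real \<times> real \<times> real \<Rightarrow> real" where
  "bivariate_wishart_density \<nu> \<gamma>1 \<gamma>2 \<gamma>3 = (\<lambda>(s, t, r).
     if s > 0 \<and> t > 0 \<and> r\<^sup>2 < s * t then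
       (\<gamma>1 * \<gamma>2 - \<gamma>3\<^sup>2) powr (- \<nu> / 2) /
         (2 powr \<nu> * sqrt pi * Gamma (\<nu> / 2) * Gamma ((\<nu> - 1) / 2)) *
       (s * t - r\<^sup>2) powr ((\<nu> - 3) / 2) *
       exp (- (\<gamma>1 * \<gamma>2) / (2 * (\<gamma>1 * \<gamma>2 - \<gamma>3\<^sup>2)) *
         (s / \<gamma>1 + t / \<gamma>2 - 2 * \<gamma>3 * r / (\<gamma>1 * \<gamma>2)))
     else 0)"

text \<open>The second parameter is the variance, whereas \<open>normal_density\<close> takes the standard deviation.\<close>

definition normal_distribution :: "real \<Rightarrow> real \<Rightarrow> real measure" where
  "normal_distribution m v = density lborel (\<lambda>x. ennreal (normal_density m (sqrt v) x))"

definition converges_in_distribution ::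
    "'a measure \<Rightarrow> (nat \<Rightarrow> 'a \<Rightarrow> real) \<Rightarrow> real measure \<Rightarrow> bool" where
  "converges_in_distribution M Y L \<longleftrightarrow> weak_conv_m (\<lambda>n. distr M borel (Y n)) L"

text \<open>
  The library's \<open>indep_var\<close> needs both random variables to have the same type of values; the
  following is its characterization \<open>indep_var_eq\<close> with two different types.
\<close>

definition indep_rv ::
    "'a measure \<Rightarrow> 'b measure \<Rightarrow> ('a \<Rightarrow> 'b) \<Rightarrow> 'c measure \<Rightarrow> ('a \<Rightarrow> 'c) \<Rightarrow> bool" where
  "indep_rv M S X T Y \<longleftrightarrow>
     X \<in> measurable M S \<and> Y \<in> measurable M T \<and>
     prob_space.indep_set M
       (sigma_sets (space M) {X -` A \<inter> space M | A. A \<in> sets S})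
       (sigma_sets (space M) {Y -` B \<inter> space M | B. B \<in> sets T})"

text \<open>
  The estimators based on a sample of size \<open>n\<close>, indexed by \<open>0, \<dots>, n - 1\<close>. The argument
  \<open>\<Theta>1\<close> is the sequence of pairs \<open>(x, y)\<close>, and \<open>\<Theta>2\<close> the sequence of triples \<open>(s, t, r)\<close>.
\<close>

definition mu_x_hat :: "(nat \<Rightarrow> 'a \<Rightarrow> real \<times> real) \<Rightarrow> nat \<Rightarrow> 'a \<Rightarrow> real" where
  "mu_x_hat \<Theta>1 n \<omega> = 1 / real n * (\<Sum>i<n. fst (\<Theta>1 i \<omega>))"

definition mu_y_hat :: "(nat \<Rightarrow> 'a \<Rightarrow> real \<times> real) \<Rightarrow> nat \<Rightarrow> 'a \<Rightarrow> real" where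
  "mu_y_hat \<Theta>1 n \<omega> = 1 / real n * (\<Sum>i<n. snd (\<Theta>1 i \<omega>))"

definition sigma_x_sq_hat :: "(nat \<Rightarrow> 'a \<Rightarrow> real \<times> real) \<Rightarrow> nat \<Rightarrow> 'a \<Rightarrow> real" where
  "sigma_x_sq_hat \<Theta>1 n \<omega> = 1 / real n * (\<Sum>i<n. (fst (\<Theta>1 i \<omega>) - mu_x_hat \<Theta>1 n \<omega>)\<^sup>2)"

definition sigma_y_sq_hat :: "(nat \<Rightarrow> 'a \<Rightarrow> real \<times> real) \<Rightarrow> nat \<Rightarrow> 'a \<Rightarrow> real" where
  "sigma_y_sq_hat \<Theta>1 n \<omega> = 1 / real n * (\<Sum>i<n. (snd (\<Theta>1 i \<omega>) - mu_y_hat \<Theta>1 n \<omega>)\<^sup>2)"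

definition sigma_xy_hat :: "(nat \<Rightarrow> 'a \<Rightarrow> real \<times> real) \<Rightarrow> nat \<Rightarrow> 'a \<Rightarrow> real" where
  "sigma_xy_hat \<Theta>1 n \<omega> = 1 / real n *
     (\<Sum>i<n. (snd (\<Theta>1 i \<omega>) - mu_y_hat \<Theta>1 n \<omega>) * (fst (\<Theta>1 i \<omega>) - mu_x_hat \<Theta>1 n \<omega>))"

definition gamma1_hat :: "real \<Rightarrow> (nat \<Rightarrow> 'a \<Rightarrow> real \<times> real \<times> real) \<Rightarrow> nat \<Rightarrow> 'a \<Rightarrow> real" where
  "gamma1_hat \<nu> \<Theta>2 n \<omega> = 1 / (real n * \<nu>) * (\<Sum>i<n. fst (\<Theta>2 i \<omega>))"

definition gamma2_hat :: "real \<Rightarrow> (nat \<Rightarrow> 'a \<Rightarrow> real \<times> real \<times> real) \<Rightarrow> nat \<Rightarrow> 'a \<Rightarrow> real" where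
  "gamma2_hat \<nu> \<Theta>2 n \<omega> = 1 / (real n * \<nu>) * (\<Sum>i<n. fst (snd (\<Theta>2 i \<omega>)))"

definition gamma3_hat :: "real \<Rightarrow> (nat \<Rightarrow> 'a \<Rightarrow> real \<times> real \<times> real) \<Rightarrow> nat \<Rightarrow> 'a \<Rightarrow> real" where
  "gamma3_hat \<nu> \<Theta>2 n \<omega> = 1 / (real n * \<nu>) * (\<Sum>i<n. snd (snd (\<Theta>2 i \<omega>)))"

end

theory Submission
  imports Defs
begin

text \<open>
  The sample covariance of \<open>n\<close> pairs is the mean of the products \<open>(y - \<mu>y) * (x - \<mu>x)\<close> minus the product
  of the two centred sample means. Multiplied by \<open>sqrt n\<close>, the latter tends to \<open>0\<close> in \<open>L\<^sup>1\<close>, so the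
  limit is the one that the central limit theorem gives for the products; the variances are the
  case \<open>x = y\<close>. The estimators of part (b) are means already. What remains is to compute moments:
  a bivariate normal vector is an affine image of two independent standard normal variables, and
  the Wishart pair \<open>(s, r)\<close> is the image of a gamma variable \<open>s\<close> and an independent standard normal
  variable \<open>v\<close> under \<open>r = \<gamma>3 / \<gamma>1 * s + sqrt ((\<gamma>1 * \<gamma>2 - \<gamma>3\<^sup>2) / \<gamma>1 * s) * v\<close>. The entry \<open>t\<close> is
  treated by exchanging the roles of \<open>s\<close> and \<open>t\<close>.
\<close>

text \<open>Since \<nu> is any real above 2, the Wishart matrix cannot be treated as a sum of \<nu>
  outer products of normal vectors, so its moments have to come from the density. Each estimator in
  part (b) reads a single entry, hence the joint law of one diagonal entry and the off-diagonal one
  is enough.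

  The variances in part (a) are those of products of normal variables and require fourth moments:
  for centred jointly normal A and B, Var(AB) = E(A^2) E(B^2) + (E(AB))^2, the source of
  \<open>2 * \<sigma>x ^ 4\<close> and of the factor \<open>1 + \<rho>\<^sup>2\<close>. Limits are
  identified by characteristic functions, so Levy's continuity theorem does the work of Slutsky's
  lemma.\<close>

section \<open>Convergence in distribution through characteristic functions\<close>

lemma normal_distribution_eq_distr:
  assumes "v > 0"
  shows "normal_distribution 0 v = distr std_normal_distribution borel (\<lambda>x. sqrt v * x)"
proof -
  interpret N: prob_space std_normal_distribution
    by (rule prob_space_normal_density) simp
  have "distributed std_normal_distribution lborel (\<lambda>x. x) std_normal_density"
    by (auto simp: distributed_def distr_id2)
  then have "distributed std_normal_distribution lborel (\<lambda>x. 0 + sqrt v * x)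
      (normal_density (0 + sqrt v * 0) (\<bar>sqrt v\<bar> * 1))"
    by (rule N.normal_density_affine) (use assms in auto)
  then have "distr std_normal_distribution lborel (\<lambda>x. sqrt v * x) = normal_distribution 0 v"
    using assms by (simp add: distributed_def normal_distribution_def)
  then show ?thesis
    by (simp cong: distr_cong)
qed

lemma real_distribution_normal_distribution:
  "v > 0 \<Longrightarrow> real_distribution (normal_distribution 0 v)"
  unfolding normal_distribution_eq_distr
  by (intro prob_space.real_distribution_distr prob_space_normal_density) auto

text \<open>Since \<open>\<bar>iexp (t * (x + y)) - iexp (t * x)\<bar> \<le> \<bar>t\<bar> * \<bar>y\<bar>\<close>, a perturbation that is null in
  \<open>L\<^sup>1\<close> does not change the limiting characteristic function.\<close>

lemma (in prob_space) converges_in_distribution_add_L1_null: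
  assumes X: "\<And>n. random_variable borel (X n)"
    and Y: "\<And>n. integrable M (Y n)"
    and null: "(\<lambda>n. expectation (\<lambda>\<omega>. \<bar>Y n \<omega>\<bar>)) \<longlonglongrightarrow> 0"
    and L: "real_distribution L"
    and conv: "converges_in_distribution M X L"
  shows "converges_in_distribution M (\<lambda>n \<omega>. X n \<omega> + Y n \<omega>) L"
  unfolding converges_in_distribution_def
proof (rule levy_continuity)
  have [measurable]: "random_variable borel (X n)" "random_variable borel (Y n)" for n
    using X Y by auto
  show "real_distribution (distr M borel (\<lambda>\<omega>. X n \<omega> + Y n \<omega>))" for n
    by simp
  show "real_distribution L" by (rule L)
  fix t
  let ?d = "\<lambda>n. char (distr M borel (\<lambda>\<omega>. X n \<omega> + Y n \<omega>)) t - char (distr M borel (X n)) t"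
  have int: "integrable M (\<lambda>\<omega>. iexp (t * Z \<omega>))" if [measurable]: "random_variable borel Z" for Z
    by (rule integrable_const_bound[of _ 1]) auto
  have "norm (?d n) \<le> \<bar>t\<bar> * expectation (\<lambda>\<omega>. \<bar>Y n \<omega>\<bar>)" for n
  proof -
    have "?d n = (CLINT \<omega>|M. iexp (t * (X n \<omega> + Y n \<omega>)) - iexp (t * X n \<omega>))"
      unfolding char_def by (simp add: integral_distr int Bochner_Integration.integral_diff
          del: of_real_add of_real_mult)
    also have "norm \<dots> \<le> (\<integral>\<omega>. norm (iexp (t * (X n \<omega> + Y n \<omega>)) - iexp (t * X n \<omega>)) \<partial>M)"
      by (rule integral_norm_bound)
    also have "\<dots> \<le> (\<integral>\<omega>. \<bar>t\<bar> * \<bar>Y n \<omega>\<bar> \<partial>M)"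
    proof (rule integral_mono)
      fix \<omega>
      have "iexp (t * (X n \<omega> + Y n \<omega>)) - iexp (t * X n \<omega>) = iexp (t * X n \<omega>) * (iexp (t * Y n \<omega>) - 1)"
        by (simp add: algebra_simps exp_add)
      then have "norm (iexp (t * (X n \<omega> + Y n \<omega>)) - iexp (t * X n \<omega>)) = norm (iexp (t * Y n \<omega>) - 1)"
        by (simp add: norm_mult)
      also have "\<dots> \<le> \<bar>t * Y n \<omega>\<bar>"
        using iexp_approx1[of "t * Y n \<omega>" 0] by simp
      finally show "norm (iexp (t * (X n \<omega> + Y n \<omega>)) - iexp (t * X n \<omega>)) \<le> \<bar>t\<bar> * \<bar>Y n \<omega>\<bar>"
        by (simp add: abs_mult)
    next
      show "integrable M (\<lambda>\<omega>. norm (iexp (t * (X n \<omega> + Y n \<omega>)) - iexp (t * X n \<omega>)))"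
        by (intro integrable_norm Bochner_Integration.integrable_diff int) measurable
    qed (use Y in auto)
    finally show ?thesis by simp
  qed
  moreover have "(\<lambda>n. \<bar>t\<bar> * expectation (\<lambda>\<omega>. \<bar>Y n \<omega>\<bar>)) \<longlonglongrightarrow> 0"
    using tendsto_mult_right_zero[OF null] .
  ultimately have "?d \<longlonglongrightarrow> 0"
    by (intro Lim_null_comparison[of ?d "\<lambda>n. \<bar>t\<bar> * expectation (\<lambda>\<omega>. \<bar>Y n \<omega>\<bar>)"]) auto
  moreover have "(\<lambda>n. char (distr M borel (X n)) t) \<longlonglongrightarrow> char L t"
    using conv unfolding converges_in_distribution_def
    by (intro levy_continuity1 L) auto
  ultimately show "(\<lambda>n. char (distr M borel (\<lambda>\<omega>. X n \<omega> + Y n \<omega>)) t) \<longlonglongrightarrow> char L t"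
    using tendsto_add by fastforce
qed

text \<open>The standard theorem divides by \<open>sqrt (n * v)\<close> and has limit N(0,1).
  Dividing by \<open>sqrt n\<close> multiplies the variables by \<open>sqrt v\<close>, that is,
  evaluates both characteristic functions at \<open>t * sqrt v\<close> instead of
  \<open>t\<close>.\<close>

lemma (in prob_space) central_limit_theorem_normal_distribution:
  fixes X :: "nat \<Rightarrow> 'a \<Rightarrow> real"
  assumes indep: "indep_vars (\<lambda>_. borel) X UNIV"
    and mean: "\<And>n. expectation (X n) = m"
    and v: "v > 0"
    and sq: "\<And>n. integrable M (\<lambda>\<omega>. (X n \<omega>)\<^sup>2)"
    and var: "\<And>n. variance (X n) = v"
    and dist: "\<And>n. distr M borel (X n) = \<mu>"
  shows "converges_in_distribution M (\<lambda>n \<omega>. (\<Sum>i<n. X i \<omega> - m) / sqrt n) (normal_distribution 0 v)"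
  unfolding converges_in_distribution_def
proof (rule levy_continuity)
  have [measurable]: "random_variable borel (X n)" for n
    using indep unfolding indep_vars_def2 by simp
  let ?S = "\<lambda>n \<omega>. (\<Sum>i<n. X i \<omega> - m) / sqrt (n * (sqrt v)\<^sup>2)"
  have conv: "weak_conv_m (\<lambda>n. distr M borel (?S n)) std_normal_distribution"
    by (rule central_limit_theorem[OF indep mean _ sq _ dist]) (use v var in auto)
  show "real_distribution (distr M borel (\<lambda>\<omega>. (\<Sum>i<n. X i \<omega> - m) / sqrt n))" for n
    by simp
  show "real_distribution (normal_distribution 0 v)"
    using v by (rule real_distribution_normal_distribution)
  fix t
  have "char (distr M borel (\<lambda>\<omega>. (\<Sum>i<n. X i \<omega> - m) / sqrt n)) t = char (distr M borel (?S n)) (t * sqrt v)" for n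
    unfolding char_def using v
    by (subst (1 2) integral_distr) (auto simp: real_sqrt_mult simp del: of_real_mult of_real_divide)
  moreover have "char (normal_distribution 0 v) t = char std_normal_distribution (t * sqrt v)"
    unfolding char_def normal_distribution_eq_distr[OF v]
    by (subst integral_distr) (auto simp: mult_ac)
  moreover have "(\<lambda>n. char (distr M borel (?S n)) (t * sqrt v)) \<longlonglongrightarrow> char std_normal_distribution (t * sqrt v)"
    by (rule levy_continuity1[OF _ real_dist_normal_dist conv]) simp
  ultimately show "(\<lambda>n. char (distr M borel (\<lambda>\<omega>. (\<Sum>i<n. X i \<omega> - m) / sqrt n)) t)
      \<longlonglongrightarrow> char (normal_distribution 0 v) t"
    by simp
qed

section \<open>The sample covariance of independent pairs\<close>

text \<open>Each new term is independent of the preceding partial sum and centred, so the cross term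
  in the square has expectation 0.\<close>

lemma (in prob_space) expectation_square_sum_indep:
  fixes U :: "nat \<Rightarrow> 'a \<Rightarrow> real"
  assumes indep: "indep_vars (\<lambda>_. borel) U UNIV"
    and mean: "\<And>i. expectation (U i) = 0"
    and sq: "\<And>i. integrable M (\<lambda>\<omega>. (U i \<omega>)\<^sup>2)"
    and q: "\<And>i. expectation (\<lambda>\<omega>. (U i \<omega>)\<^sup>2) = q"
  shows "integrable M (\<lambda>\<omega>. (\<Sum>i<n. U i \<omega>)\<^sup>2) \<and> expectation (\<lambda>\<omega>. (\<Sum>i<n. U i \<omega>)\<^sup>2) = n * q"
proof (induction n)
  case (Suc n)
  have [measurable]: "random_variable borel (U i)" for i
    using indep unfolding indep_vars_def2 by simp
  have int: "integrable M (U i)" for i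
    by (rule square_integrable_imp_integrable[OF _ sq]) simp
  have "indep_var borel (U n) borel (\<lambda>\<omega>. \<Sum>i<n. U i \<omega>)"
    by (intro indep_vars_sum) (auto intro: indep_vars_subset[OF indep])
  then have cross: "integrable M (\<lambda>\<omega>. U n \<omega> * (\<Sum>i<n. U i \<omega>))"
    "expectation (\<lambda>\<omega>. U n \<omega> * (\<Sum>i<n. U i \<omega>)) = 0"
    using indep_var_integrable[of "U n" "\<lambda>\<omega>. \<Sum>i<n. U i \<omega>"]
      indep_var_lebesgue_integral[of "U n" "\<lambda>\<omega>. \<Sum>i<n. U i \<omega>"] mean
    by (auto simp: int)
  have "(\<Sum>i<Suc n. U i \<omega>)\<^sup>2 = (\<Sum>i<n. U i \<omega>)\<^sup>2 + 2 * (U n \<omega> * (\<Sum>i<n. U i \<omega>)) + (U n \<omega>)\<^sup>2" for \<omega>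
    by (simp add: power2_eq_square algebra_simps)
  then show ?case
    using Suc cross sq q by (simp add: algebra_simps)
qed simp

text \<open>Independence and equality of laws are required of the pairs across i; the dependence
  within a pair enters the limit only through the mean \<open>c\<close> and variance
  \<open>v\<close> of the product. The second moments \<open>vx\<close> and \<open>vy\<close> serve
  to control the remainder.\<close>

lemma (in prob_space) sample_covariance_central_limit:
  fixes X Y :: "nat \<Rightarrow> 'a \<Rightarrow> real"
    and mx my :: real
  defines "Z \<equiv> \<lambda>i \<omega>. (Y i \<omega> - my) * (X i \<omega> - mx)"
  assumes indep: "indep_vars (\<lambda>_. borel) (\<lambda>i \<omega>. (X i \<omega>, Y i \<omega>)) UNIV"
    and dist: "\<And>i. distr M borel (\<lambda>\<omega>. (X i \<omega>, Y i \<omega>)) = \<mu>"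
    and X: "\<And>i. expectation (\<lambda>\<omega>. X i \<omega> - mx) = 0" "\<And>i. integrable M (\<lambda>\<omega>. (X i \<omega> - mx)\<^sup>2)"
      "\<And>i. expectation (\<lambda>\<omega>. (X i \<omega> - mx)\<^sup>2) = vx"
    and Y: "\<And>i. expectation (\<lambda>\<omega>. Y i \<omega> - my) = 0" "\<And>i. integrable M (\<lambda>\<omega>. (Y i \<omega> - my)\<^sup>2)"
      "\<And>i. expectation (\<lambda>\<omega>. (Y i \<omega> - my)\<^sup>2) = vy"
    and Z: "\<And>i. expectation (Z i) = c" "\<And>i. integrable M (\<lambda>\<omega>. (Z i \<omega>)\<^sup>2)"
      "\<And>i. variance (Z i) = v"
    and v: "v > 0"
  shows "converges_in_distribution M (\<lambda>n \<omega>. sqrt (real n) * (1 / real n * (\<Sum>i<n.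
      (Y i \<omega> - 1 / real n * (\<Sum>i<n. Y i \<omega>)) * (X i \<omega> - 1 / real n * (\<Sum>i<n. X i \<omega>))) - c))
    (normal_distribution 0 v)"
proof -
  have XY [measurable]: "random_variable (borel \<Otimes>\<^sub>M borel) (\<lambda>\<omega>. (X i \<omega>, Y i \<omega>))" for i
    using indep unfolding indep_vars_def2 by (simp add: borel_prod)
  have [measurable]: "random_variable borel (X i)" "random_variable borel (Y i)" for i
    using measurable_compose[OF XY measurable_fst] measurable_compose[OF XY measurable_snd]
    by (simp_all add: comp_def)
  have [measurable]: "random_variable borel (Z i)" for i
    unfolding Z_def by measurable
  have indep': "indep_vars (\<lambda>_. borel) (\<lambda>i \<omega>. f (X i \<omega>, Y i \<omega>)) UNIV"
    if "f \<in> borel_measurable borel" for f :: "real \<times> real \<Rightarrow> real"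
    using indep_vars_compose2[OF indep, of "\<lambda>_. f" "\<lambda>_. borel"] that by simp
  have indepX: "indep_vars (\<lambda>_. borel) (\<lambda>i \<omega>. X i \<omega> - mx) UNIV"
    using indep'[of "\<lambda>p. fst p - mx"] by (simp flip: borel_prod)
  have indepY: "indep_vars (\<lambda>_. borel) (\<lambda>i \<omega>. Y i \<omega> - my) UNIV"
    using indep'[of "\<lambda>p. snd p - my"] by (simp flip: borel_prod)
  have mZ: "(\<lambda>p. (snd p - my) * (fst p - mx)) \<in> borel_measurable borel"
    by (simp flip: borel_prod)
  have indepZ: "indep_vars (\<lambda>_. borel) Z UNIV"
    using indep'[OF mZ] by (simp add: Z_def)
  have distZ: "distr M borel (Z i) = distr \<mu> borel (\<lambda>p. (snd p - my) * (fst p - mx))" for i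
    unfolding dist[of i, symmetric] Z_def
    by (subst distr_distr[OF mZ]) (use XY[of i] in \<open>auto simp: comp_def borel_prod\<close>)
  let ?W = "\<lambda>n \<omega>. - (sqrt n * ((\<Sum>i<n. X i \<omega> - mx) / n * ((\<Sum>i<n. Y i \<omega> - my) / n)))"
  let ?SX = "\<lambda>n \<omega>. \<Sum>i<n. X i \<omega> - mx" and ?SY = "\<lambda>n \<omega>. \<Sum>i<n. Y i \<omega> - my"
  have SX: "integrable M (\<lambda>\<omega>. (?SX n \<omega>)\<^sup>2)" "expectation (\<lambda>\<omega>. (?SX n \<omega>)\<^sup>2) = n * vx" for n
    using expectation_square_sum_indep[OF indepX X] by auto
  have SY: "integrable M (\<lambda>\<omega>. (?SY n \<omega>)\<^sup>2)" "expectation (\<lambda>\<omega>. (?SY n \<omega>)\<^sup>2) = n * vy" for n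
    using expectation_square_sum_indep[OF indepY Y] by auto
  \<comment> \<open>The product of the two sums is replaced by their squares, whose expectations are
    \<open>n * vx\<close> and \<open>n * vy\<close>. The prefactor \<open>sqrt n / n\<^sup>2\<close>
    then leaves order \<open>1 / sqrt n\<close>.\<close>
  have bound: "\<bar>?W n \<omega>\<bar> \<le> sqrt n / n\<^sup>2 * ((?SX n \<omega>)\<^sup>2 + (?SY n \<omega>)\<^sup>2)" for n \<omega>
  proof -
    have "\<bar>?SX n \<omega>\<bar> * \<bar>?SY n \<omega>\<bar> \<le> (?SX n \<omega>)\<^sup>2 + (?SY n \<omega>)\<^sup>2"
      using sum_squares_bound[of "\<bar>?SX n \<omega>\<bar>" "\<bar>?SY n \<omega>\<bar>"] mult_nonneg_nonneg[of "\<bar>?SX n \<omega>\<bar>" "\<bar>?SY n \<omega>\<bar>"]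
      by (simp only: power2_abs) linarith
    then have "sqrt n / n\<^sup>2 * (\<bar>?SX n \<omega>\<bar> * \<bar>?SY n \<omega>\<bar>) \<le> sqrt n / n\<^sup>2 * ((?SX n \<omega>)\<^sup>2 + (?SY n \<omega>)\<^sup>2)"
      by (rule mult_left_mono) simp
    then show ?thesis
      by (simp add: abs_mult power2_eq_square)
  qed
  have intW: "integrable M (?W n)" for n
    by (rule Bochner_Integration.integrable_bound[where f = "\<lambda>\<omega>. sqrt n / n\<^sup>2 * ((?SX n \<omega>)\<^sup>2 + (?SY n \<omega>)\<^sup>2)"])
      (use bound SX SY in \<open>auto intro: order_trans[OF _ abs_ge_self]\<close>)
  have null: "(\<lambda>n. expectation (\<lambda>\<omega>. \<bar>?W n \<omega>\<bar>)) \<longlonglongrightarrow> 0"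
  proof (rule Lim_null_comparison)
    show "\<forall>\<^sub>F n in sequentially. norm (expectation (\<lambda>\<omega>. \<bar>?W n \<omega>\<bar>)) \<le> (vx + vy) * inverse (sqrt n)"
    proof (intro always_eventually allI)
      fix n :: nat
      have "expectation (\<lambda>\<omega>. \<bar>?W n \<omega>\<bar>) \<le> expectation (\<lambda>\<omega>. sqrt n / n\<^sup>2 * ((?SX n \<omega>)\<^sup>2 + (?SY n \<omega>)\<^sup>2))"
      proof (rule integral_mono)
        show "integrable M (\<lambda>\<omega>. \<bar>?W n \<omega>\<bar>)"
          by (rule integrable_abs[OF intW])
      qed (use bound SX SY in auto)
      also have "expectation (\<lambda>\<omega>. sqrt n / n\<^sup>2 * ((?SX n \<omega>)\<^sup>2 + (?SY n \<omega>)\<^sup>2)) = sqrt n / n\<^sup>2 * (n * vx + n * vy)"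
        by (simp only: integral_mult_right_zero Bochner_Integration.integral_add[OF SX(1) SY(1)] SX(2) SY(2))
      \<comment> \<open>For n = 0 both sides are 0, as division by zero yields zero.\<close>
      also have "\<dots> = (vx + vy) * inverse (sqrt n)"
        by (cases "n = 0") (auto simp: field_simps power2_eq_square)
      finally show "norm (expectation (\<lambda>\<omega>. \<bar>?W n \<omega>\<bar>)) \<le> (vx + vy) * inverse (sqrt n)"
        by simp
    qed
    show "(\<lambda>n. (vx + vy) * inverse (sqrt n)) \<longlonglongrightarrow> 0"
      by (intro tendsto_mult_right_zero tendsto_inverse_0_at_top
          filterlim_compose[OF sqrt_at_top filterlim_real_sequentially])
  qed
  have "converges_in_distribution M (\<lambda>n \<omega>. (\<Sum>i<n. Z i \<omega> - c) / sqrt n + ?W n \<omega>) (normal_distribution 0 v)"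
    by (rule converges_in_distribution_add_L1_null[OF _ intW null])
      (use v in \<open>auto intro!: real_distribution_normal_distribution
        central_limit_theorem_normal_distribution[OF indepZ Z(1) v Z(2,3) distZ]\<close>)
  moreover have "(\<lambda>n \<omega>. (\<Sum>i<n. Z i \<omega> - c) / sqrt n + ?W n \<omega>) =
     (\<lambda>n \<omega>. sqrt (real n) * (1 / real n * (\<Sum>i<n.
      (Y i \<omega> - 1 / real n * (\<Sum>i<n. Y i \<omega>)) * (X i \<omega> - 1 / real n * (\<Sum>i<n. X i \<omega>))) - c))"
  proof (intro ext)
    fix n :: nat and \<omega>
    show "(\<Sum>i<n. Z i \<omega> - c) / sqrt n + ?W n \<omega> = sqrt (real n) * (1 / real n * (\<Sum>i<n.
      (Y i \<omega> - 1 / real n * (\<Sum>i<n. Y i \<omega>)) * (X i \<omega> - 1 / real n * (\<Sum>i<n. X i \<omega>))) - c)"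
    \<comment> \<open>For n = 0 the sum is empty and \<open>sqrt 0 = 0\<close>, so both sides
      vanish.\<close>
    proof (cases "n = 0")
      case False
      \<comment> \<open>Shifting all observations by a constant does not change their deviations
        from the sample mean, so everything can be written in deviations from \<open>mx\<close> and
        \<open>my\<close>.\<close>
      define x y where "x i = X i \<omega> - mx" and "y i = Y i \<omega> - my" for i
      define a b where "a = (\<Sum>i<n. x i) / n" and "b = (\<Sum>i<n. y i) / n"
      have ab: "(\<Sum>i<n. x i) = n * a" "(\<Sum>i<n. y i) = n * b"
        using False by (auto simp: a_def b_def)
      have centred: "X i \<omega> - 1 / real n * (\<Sum>i<n. X i \<omega>) = x i - a"
        "Y i \<omega> - 1 / real n * (\<Sum>i<n. Y i \<omega>) = y i - b" for i
        using False by (auto simp: x_def y_def a_def b_def sum_subtractf field_simps)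
      have "(\<Sum>i<n. (Y i \<omega> - 1 / real n * (\<Sum>i<n. Y i \<omega>)) * (X i \<omega> - 1 / real n * (\<Sum>i<n. X i \<omega>)))
          = (\<Sum>i<n. y i * x i - b * x i - a * y i + a * b)"
        unfolding centred by (simp add: algebra_simps)
      \<comment> \<open>Each of the two mixed sums contributes \<open>- n * (a * b)\<close> and the
        constant term \<open>+ n * (a * b)\<close>; one negative copy remains.\<close>
      also have "\<dots> = (\<Sum>i<n. y i * x i) - n * (a * b)"
        by (simp add: sum.distrib sum_subtractf flip: sum_distrib_left) (simp add: ab)
      finally have cov: "(\<Sum>i<n. (Y i \<omega> - 1 / real n * (\<Sum>i<n. Y i \<omega>)) * (X i \<omega> - 1 / real n * (\<Sum>i<n. X i \<omega>)))
          = (\<Sum>i<n. y i * x i) - n * (a * b)" .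
      have z: "(\<Sum>i<n. Z i \<omega> - c) = (\<Sum>i<n. y i * x i) - n * c"
        by (simp add: Z_def x_def y_def sum_subtractf)
      have w: "?W n \<omega> = - (sqrt n * (a * b))"
        by (simp add: a_def b_def x_def y_def)
      have r: "p / sqrt n = sqrt n * (p / n)" for p
        using False by (simp add: field_simps)
      show ?thesis
        unfolding cov z w r using False by (simp add: field_simps)
    qed simp
  qed
  ultimately show ?thesis by simp
qed

section \<open>Bivariate normal vectors: representation and fourth moments\<close>

text \<open>Fubini for a separated integrand. Integrability and value come together, so that moments
  under the product measures, normal and gamma-normal alike, reduce to one-dimensional ones.\<close>

lemma has_bochner_integral_pair_mult:
  fixes f :: "'a \<Rightarrow> real" and g :: "'b \<Rightarrow> real"
  assumes "sigma_finite_measure M1" "sigma_finite_measure M2"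
    and f: "has_bochner_integral M1 f a" and g: "has_bochner_integral M2 g b"
  shows "has_bochner_integral (M1 \<Otimes>\<^sub>M M2) (\<lambda>(x, y). f x * g y) (a * b)"
proof -
  interpret M1: sigma_finite_measure M1 by fact
  interpret M2: sigma_finite_measure M2 by fact
  interpret pair_sigma_finite M1 M2 ..
  have [simp]: "integrable M1 f" "integrable M2 g" "integral\<^sup>L M1 f = a" "integral\<^sup>L M2 g = b"
    using f g by (auto simp: has_bochner_integral_iff)
  have [measurable]: "f \<in> borel_measurable M1" "g \<in> borel_measurable M2"
    by (simp_all add: borel_measurable_integrable)
  have int: "integrable (M1 \<Otimes>\<^sub>M M2) (\<lambda>(x, y). f x * g y)"
    by (rule Fubini_integrable) (auto simp: abs_mult)
  have "integral\<^sup>L (M1 \<Otimes>\<^sub>M M2) (\<lambda>(x, y). f x * g y) = a * b"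
    by (subst integral_fst[OF int, symmetric]) simp
  then show ?thesis
    using int by (simp add: has_bochner_integral_iff)
qed

lemma sigma_finite_std_normal_distribution: "sigma_finite_measure std_normal_distribution"
  by (intro prob_space_imp_sigma_finite prob_space_normal_density) simp

text \<open>Substitution x = m + \<sigma> v, for nonnegative integrands so that it applies inside an
  iterated integral, where \<open>m\<close> and \<open>\<sigma>\<close> may depend on the outer
  variable.\<close>

lemma nn_integral_normal_density_affine:
  assumes "\<sigma> > 0" and [measurable]: "f \<in> borel_measurable borel"
  shows "(\<integral>\<^sup>+x. ennreal (normal_density m \<sigma> x) * f x \<partial>lborel)
    = (\<integral>\<^sup>+v. f (m + \<sigma> * v) \<partial>std_normal_distribution)"
proof -
  have eq: "\<sigma> * normal_density m \<sigma> (m + \<sigma> * v) = std_normal_density v" for v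
    using assms(1) by (simp add: normal_density_def real_sqrt_mult power_mult_distrib field_simps)
  have "(\<integral>\<^sup>+x. ennreal (normal_density m \<sigma> x) * f x \<partial>lborel)
      = \<bar>\<sigma>\<bar> * (\<integral>\<^sup>+v. ennreal (normal_density m \<sigma> (m + \<sigma> * v)) * f (m + \<sigma> * v) \<partial>lborel)"
    using assms(1) by (intro nn_integral_real_affine) auto
  also have "\<dots> = (\<integral>\<^sup>+v. ennreal (\<sigma> * normal_density m \<sigma> (m + \<sigma> * v)) * f (m + \<sigma> * v) \<partial>lborel)"
    using assms(1) by (subst nn_integral_cmult[symmetric]) (auto simp: ennreal_mult mult_ac)
  finally show ?thesis
    by (simp add: eq nn_integral_density)
qed

text \<open>Marginal density of x times conditional density of y given x. In standardized variables
  the quadratic form is \<open>(1 - \<rho>\<^sup>2) * u\<^sup>2 + (v - \<rho> * u)\<^sup>2\<close>,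
  by completing the square in v.\<close>

lemma bivariate_normal_density_eq_mult:
  assumes "\<sigma>x > 0" "\<sigma>y > 0" "\<bar>\<rho>\<bar> < 1"
  shows "bivariate_normal_density \<mu>x \<mu>y \<sigma>x \<sigma>y \<rho> (x, y) =
    normal_density \<mu>x \<sigma>x x *
    normal_density (\<mu>y + \<rho> * \<sigma>y / \<sigma>x * (x - \<mu>x)) (\<sigma>y * sqrt (1 - \<rho>\<^sup>2)) y"
proof -
  have q: "1 - \<rho>\<^sup>2 > 0"
    using assms(3) by (simp add: abs_square_less_1)
  define u v where "u = (x - \<mu>x) / \<sigma>x" and "v = (y - \<mu>y) / \<sigma>y"
  have x: "x - \<mu>x = \<sigma>x * u" and y: "y - \<mu>y = \<sigma>y * v"
    using assms by (auto simp: u_def v_def)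
  have y': "y - (\<mu>y + \<rho> * \<sigma>y / \<sigma>x * (x - \<mu>x)) = \<sigma>y * (v - \<rho> * u)"
    using assms y by (simp add: x algebra_simps)
  have e: "- 1 / (2 * (1 - \<rho>\<^sup>2)) * (u\<^sup>2 - 2 * \<rho> * u * v + v\<^sup>2)
      = - u\<^sup>2 / 2 + - (v - \<rho> * u)\<^sup>2 / (2 * (1 - \<rho>\<^sup>2))"
    using q by (simp add: divide_simps power2_diff power_mult_distrib) (simp add: algebra_simps)
  have "bivariate_normal_density \<mu>x \<mu>y \<sigma>x \<sigma>y \<rho> (x, y) =
    1 / (2 * pi * \<sigma>x * \<sigma>y * sqrt (1 - \<rho>\<^sup>2)) * exp (- u\<^sup>2 / 2 + - (v - \<rho> * u)\<^sup>2 / (2 * (1 - \<rho>\<^sup>2)))"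
    unfolding bivariate_normal_density_def prod.case u_def[symmetric] v_def[symmetric] e[symmetric] ..
  also have "\<dots> = normal_density \<mu>x \<sigma>x x *
      normal_density (\<mu>y + \<rho> * \<sigma>y / \<sigma>x * (x - \<mu>x)) (\<sigma>y * sqrt (1 - \<rho>\<^sup>2)) y"
  proof -
    have "normal_density \<mu>x \<sigma>x x = 1 / (\<sigma>x * sqrt (2 * pi)) * exp (- u\<^sup>2 / 2)"
      unfolding normal_density_def x using assms by (simp add: power_mult_distrib real_sqrt_mult)
    moreover have "normal_density (\<mu>y + \<rho> * \<sigma>y / \<sigma>x * (x - \<mu>x)) (\<sigma>y * sqrt (1 - \<rho>\<^sup>2)) y
        = 1 / (\<sigma>y * sqrt (1 - \<rho>\<^sup>2) * sqrt (2 * pi)) * exp (- (v - \<rho> * u)\<^sup>2 / (2 * (1 - \<rho>\<^sup>2)))"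
      unfolding normal_density_def y' using assms q by (simp add: power_mult_distrib real_sqrt_mult)
    moreover have "2 * pi * \<sigma>x * \<sigma>y * sqrt (1 - \<rho>\<^sup>2)
        = (\<sigma>x * sqrt (2 * pi)) * (\<sigma>y * sqrt (1 - \<rho>\<^sup>2) * sqrt (2 * pi))"
      using real_sqrt_mult_self[of "2 * pi"] by (simp add: mult_ac)
    ultimately show ?thesis
      unfolding exp_add by simp
  qed
  finally show ?thesis .
qed

text \<open>The coefficients are the lower triangular Cholesky factor of the covariance matrix: x is
  generated from u alone, then y from its conditional law given x with fresh noise v. Both measures
  are compared on Borel sets by standardizing the inner variable, then the outer one.\<close>

lemma bivariate_normal_eq_distr:
  assumes "\<sigma>x > 0" "\<sigma>y > 0" "\<bar>\<rho>\<bar> < 1"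
    and [measurable]: "bivariate_normal_density \<mu>x \<mu>y \<sigma>x \<sigma>y \<rho> \<in> borel_measurable borel"
  shows "density lborel (bivariate_normal_density \<mu>x \<mu>y \<sigma>x \<sigma>y \<rho>) =
    distr (std_normal_distribution \<Otimes>\<^sub>M std_normal_distribution) borel
      (\<lambda>(u, v). (\<mu>x + \<sigma>x * u, \<mu>y + (\<sigma>y * \<rho> * u + \<sigma>y * sqrt (1 - \<rho>\<^sup>2) * v)))"
    (is "?D = distr ?P borel ?T")
proof (rule measure_eqI)
  let ?N = std_normal_distribution and ?f = "bivariate_normal_density \<mu>x \<mu>y \<sigma>x \<sigma>y \<rho>"
  interpret N: sigma_finite_measure ?N by (rule sigma_finite_std_normal_distribution)
  have s: "sqrt (1 - \<rho>\<^sup>2) > 0"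
    using assms(3) by (simp add: abs_square_less_1)
  have T [measurable]: "?T \<in> ?P \<rightarrow>\<^sub>M borel"
    by (simp flip: borel_prod)
  fix A assume "A \<in> sets ?D"
  then have [measurable]: "A \<in> sets (borel \<Otimes>\<^sub>M borel)"
    unfolding borel_prod by simp
  have [measurable]: "A \<in> sets borel" using \<open>A \<in> sets ?D\<close> by simp
  have [measurable]: "?f \<in> borel_measurable (lborel \<Otimes>\<^sub>M lborel)"
    using assms(4) by (simp add: lborel_prod)
  have [measurable]: "indicator A \<in> borel_measurable (lborel \<Otimes>\<^sub>M lborel)"
    by (simp add: lborel_prod)
  let ?m = "\<lambda>x. \<mu>y + \<rho> * \<sigma>y / \<sigma>x * (x - \<mu>x)" and ?s = "\<sigma>y * sqrt (1 - \<rho>\<^sup>2)"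
  have "emeasure ?D A = (\<integral>\<^sup>+z. ennreal (?f z) * indicator A z \<partial>(lborel \<Otimes>\<^sub>M lborel))"
    by (simp add: emeasure_density lborel_prod)
  also have "\<dots> = (\<integral>\<^sup>+x. \<integral>\<^sup>+y. ennreal (?f (x, y)) * indicator A (x, y) \<partial>lborel \<partial>lborel)"
    by (rule lborel.nn_integral_fst[symmetric]) measurable
  also have "\<dots> = (\<integral>\<^sup>+x. ennreal (normal_density \<mu>x \<sigma>x x) *
      (\<integral>\<^sup>+y. ennreal (normal_density (?m x) ?s y) * indicator A (x, y) \<partial>lborel) \<partial>lborel)"
    by (subst nn_integral_cmult[symmetric])
      (auto simp: bivariate_normal_density_eq_mult[OF assms(1-3)] ennreal_mult mult_ac)
  also have "\<dots> = (\<integral>\<^sup>+x. ennreal (normal_density \<mu>x \<sigma>x x) *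
      (\<integral>\<^sup>+v. indicator A (x, ?m x + ?s * v) \<partial>?N) \<partial>lborel)"
    using assms s by (subst nn_integral_normal_density_affine) auto
  also have "\<dots> = (\<integral>\<^sup>+u. \<integral>\<^sup>+v. indicator A (\<mu>x + \<sigma>x * u, ?m (\<mu>x + \<sigma>x * u) + ?s * v) \<partial>?N \<partial>?N)"
    using assms(1) by (rule nn_integral_normal_density_affine) measurable
  \<comment> \<open>At \<open>x = \<mu>x + \<sigma>x * u\<close> the conditional mean
    \<open>?m\<close> becomes \<open>\<mu>y + \<sigma>y * \<rho> * u\<close>.\<close>
  also have "\<dots> = (\<integral>\<^sup>+u. \<integral>\<^sup>+v. indicator A (?T (u, v)) \<partial>?N \<partial>?N)"
    using assms by (intro nn_integral_cong) (simp add: algebra_simps)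
  also have "\<dots> = (\<integral>\<^sup>+z. indicator A (?T z) \<partial>?P)"
    by (rule N.nn_integral_fst) measurable
  also have "\<dots> = (\<integral>\<^sup>+z. indicator A z \<partial>distr ?P borel ?T)"
    by (rule nn_integral_distr[symmetric]) measurable
  also have "\<dots> = emeasure (distr ?P borel ?T) A"
    by simp
  finally show "emeasure ?D A = emeasure (distr ?P borel ?T) A" .
qed simp

lemma std_normal_pair_moment:
  "has_bochner_integral (std_normal_distribution \<Otimes>\<^sub>M std_normal_distribution) (\<lambda>(u, v). u ^ i * v ^ j)
    ((\<integral>u. u ^ i \<partial>std_normal_distribution) * (\<integral>v. v ^ j \<partial>std_normal_distribution))"
  by (intro has_bochner_integral_pair_mult sigma_finite_std_normal_distribution)
    (auto simp: has_bochner_integral_iff integrable_density intro: integrable_std_normal_moment)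

text \<open>The last fact is the moment of order 0, in the form which the integral of the constant 1
  takes.\<close>

lemma std_normal_moments:
  "(\<integral>u. u \<partial>std_normal_distribution) = 0" "(\<integral>u. u\<^sup>2 \<partial>std_normal_distribution) = 1"
  "(\<integral>u. u ^ 3 \<partial>std_normal_distribution) = 0" "(\<integral>u. u ^ 4 \<partial>std_normal_distribution) = 3"
  "measure std_normal_distribution UNIV = 1"
proof -
  interpret N: prob_space std_normal_distribution
    by (rule prob_space_normal_density) simp
  show "measure std_normal_distribution UNIV = 1"
    using N.prob_space by simp
qed (use integral_std_normal_moment_odd[of 0] integral_std_normal_moment_odd[of 1]
    integral_std_normal_moment_even[of 1] integral_std_normal_moment_even[of 2]
    in \<open>simp_all add: integral_density fact_numeral\<close>)

text \<open>The third claim is Isserlis' formula E(A^2 B^2) = E(A^2) E(B^2) + 2 (E(AB))^2, obtained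
  by expanding into monomials in the two independent coordinates.\<close>

lemma std_normal_pair_linear_moments:
  fixes a1 a2 b1 b2 :: real
  defines "A \<equiv> \<lambda>z. a1 * fst z + a2 * snd z" and "B \<equiv> \<lambda>z. b1 * fst z + b2 * snd z"
  defines "P \<equiv> std_normal_distribution \<Otimes>\<^sub>M std_normal_distribution"
  shows "has_bochner_integral P A 0"
    and "has_bochner_integral P (\<lambda>z. A z * B z) (a1 * b1 + a2 * b2)"
    and "has_bochner_integral P (\<lambda>z. (A z * B z)\<^sup>2)
      ((a1\<^sup>2 + a2\<^sup>2) * (b1\<^sup>2 + b2\<^sup>2) + 2 * (a1 * b1 + a2 * b2)\<^sup>2)"
proof -
  define I where "I i j = (\<integral>u. u ^ i \<partial>std_normal_distribution) * (\<integral>v. v ^ j \<partial>std_normal_distribution)" for i j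
  have m: "has_bochner_integral P (\<lambda>(u, v). c * (u ^ i * v ^ j)) (c * I i j)" for c i j
  proof -
    have "(\<lambda>(u, v). c * (u ^ i * v ^ j)) = (\<lambda>z. c * (case z of (u, v) \<Rightarrow> u ^ i * v ^ j))"
      by auto
    then show ?thesis
      unfolding P_def I_def
      by (simp only:) (intro has_bochner_integral_mult_right std_normal_pair_moment)
  qed
  note I = I_def std_normal_moments
  \<comment> \<open>Exponents 0 and 1 are written out so that every summand is an instance of
    \<open>m\<close>.\<close>
  have "has_bochner_integral P (\<lambda>z. (case z of (u, v) \<Rightarrow> a1 * (u ^ 1 * v ^ 0)) + (case z of (u, v) \<Rightarrow> a2 * (u ^ 0 * v ^ 1)))
    (a1 * I 1 0 + a2 * I 0 1)"
    by (intro has_bochner_integral_add m)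
  then show "has_bochner_integral P A 0"
    by (simp add: I A_def case_prod_beta)
  have "has_bochner_integral P (\<lambda>z. (case z of (u, v) \<Rightarrow> a1 * b1 * (u ^ 2 * v ^ 0))
      + (case z of (u, v) \<Rightarrow> (a1 * b2 + a2 * b1) * (u ^ 1 * v ^ 1))
      + (case z of (u, v) \<Rightarrow> a2 * b2 * (u ^ 0 * v ^ 2)))
    (a1 * b1 * I 2 0 + (a1 * b2 + a2 * b1) * I 1 1 + a2 * b2 * I 0 2)"
    by (intro has_bochner_integral_add m)
  moreover have "A z * B z = (case z of (u, v) \<Rightarrow> a1 * b1 * (u ^ 2 * v ^ 0))
      + (case z of (u, v) \<Rightarrow> (a1 * b2 + a2 * b1) * (u ^ 1 * v ^ 1))
      + (case z of (u, v) \<Rightarrow> a2 * b2 * (u ^ 0 * v ^ 2))" for z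
    by (cases z) (simp add: A_def B_def algebra_simps power2_eq_square)
  ultimately show "has_bochner_integral P (\<lambda>z. A z * B z) (a1 * b1 + a2 * b2)"
    by (simp add: I)
  \<comment> \<open>The square of the quadratic form \<open>a1 * b1 * u\<^sup>2 + (a1 * b2 + a2 *
    b1) * u * v + a2 * b2 * v\<^sup>2\<close>, collected by monomials.\<close>
  have "has_bochner_integral P (\<lambda>z. (case z of (u, v) \<Rightarrow> a1\<^sup>2 * b1\<^sup>2 * (u ^ 4 * v ^ 0))
      + (case z of (u, v) \<Rightarrow> 2 * a1 * b1 * (a1 * b2 + a2 * b1) * (u ^ 3 * v ^ 1))
      + (case z of (u, v) \<Rightarrow> ((a1 * b2 + a2 * b1)\<^sup>2 + 2 * a1 * a2 * b1 * b2) * (u ^ 2 * v ^ 2))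
      + (case z of (u, v) \<Rightarrow> 2 * a2 * b2 * (a1 * b2 + a2 * b1) * (u ^ 1 * v ^ 3))
      + (case z of (u, v) \<Rightarrow> a2\<^sup>2 * b2\<^sup>2 * (u ^ 0 * v ^ 4)))
    (a1\<^sup>2 * b1\<^sup>2 * I 4 0 + 2 * a1 * b1 * (a1 * b2 + a2 * b1) * I 3 1
      + ((a1 * b2 + a2 * b1)\<^sup>2 + 2 * a1 * a2 * b1 * b2) * I 2 2
      + 2 * a2 * b2 * (a1 * b2 + a2 * b1) * I 1 3 + a2\<^sup>2 * b2\<^sup>2 * I 0 4)"
    by (intro has_bochner_integral_add m)
  moreover have "(A z * B z)\<^sup>2 = (case z of (u, v) \<Rightarrow> a1\<^sup>2 * b1\<^sup>2 * (u ^ 4 * v ^ 0))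
      + (case z of (u, v) \<Rightarrow> 2 * a1 * b1 * (a1 * b2 + a2 * b1) * (u ^ 3 * v ^ 1))
      + (case z of (u, v) \<Rightarrow> ((a1 * b2 + a2 * b1)\<^sup>2 + 2 * a1 * a2 * b1 * b2) * (u ^ 2 * v ^ 2))
      + (case z of (u, v) \<Rightarrow> 2 * a2 * b2 * (a1 * b2 + a2 * b1) * (u ^ 1 * v ^ 3))
      + (case z of (u, v) \<Rightarrow> a2\<^sup>2 * b2\<^sup>2 * (u ^ 0 * v ^ 4))" for z
    by (simp add: A_def B_def case_prod_beta power2_eq_square power3_eq_cube power4_eq_xxxx algebra_simps)
  \<comment> \<open>Terms with odd exponents vanish; \<open>I 4 0 = I 0 4 = 3\<close> and
    \<open>I 2 2 = 1\<close>.\<close>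
  moreover have "a1\<^sup>2 * b1\<^sup>2 * I 4 0 + 2 * a1 * b1 * (a1 * b2 + a2 * b1) * I 3 1
      + ((a1 * b2 + a2 * b1)\<^sup>2 + 2 * a1 * a2 * b1 * b2) * I 2 2
      + 2 * a2 * b2 * (a1 * b2 + a2 * b1) * I 1 3 + a2\<^sup>2 * b2\<^sup>2 * I 0 4
      = (a1\<^sup>2 + a2\<^sup>2) * (b1\<^sup>2 + b2\<^sup>2) + 2 * (a1 * b1 + a2 * b2)\<^sup>2"
    by (simp add: I, algebra)
  ultimately show "has_bochner_integral P (\<lambda>z. (A z * B z)\<^sup>2)
      ((a1\<^sup>2 + a2\<^sup>2) * (b1\<^sup>2 + b2\<^sup>2) + 2 * (a1 * b1 + a2 * b2)\<^sup>2)"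
    by simp
qed

lemma (in prob_space) gaussian_sample_covariance_central_limit:
  fixes X Y :: "nat \<Rightarrow> 'a \<Rightarrow> real" and mx my a1 a2 b1 b2 :: real
  defines "T \<equiv> \<lambda>z. (mx + (a1 * fst z + a2 * snd z), my + (b1 * fst z + b2 * snd z))"
  defines "v \<equiv> (a1\<^sup>2 + a2\<^sup>2) * (b1\<^sup>2 + b2\<^sup>2) + (a1 * b1 + a2 * b2)\<^sup>2"
  assumes indep: "indep_vars (\<lambda>_. borel) (\<lambda>i \<omega>. (X i \<omega>, Y i \<omega>)) UNIV"
    and dist: "\<And>i. distr M borel (\<lambda>\<omega>. (X i \<omega>, Y i \<omega>)) =
      distr (std_normal_distribution \<Otimes>\<^sub>M std_normal_distribution) borel T"
    and v: "v > 0"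
  shows "converges_in_distribution M (\<lambda>n \<omega>. sqrt (real n) * (1 / real n * (\<Sum>i<n.
      (Y i \<omega> - 1 / real n * (\<Sum>i<n. Y i \<omega>)) * (X i \<omega> - 1 / real n * (\<Sum>i<n. X i \<omega>))) - (a1 * b1 + a2 * b2)))
    (normal_distribution 0 v)"
proof -
  let ?P = "std_normal_distribution \<Otimes>\<^sub>M std_normal_distribution"
  have XY [measurable]: "random_variable borel (\<lambda>\<omega>. (X i \<omega>, Y i \<omega>))" for i
    using indep unfolding indep_vars_def2 by simp
  have T [measurable]: "T \<in> ?P \<rightarrow>\<^sub>M borel"
    unfolding T_def by (simp flip: borel_prod)
  \<comment> \<open>Moments of a pair are read off from the standard normal pair: \<open>h\<close>
    is \<open>g\<close> composed with the affine map \<open>T\<close>.\<close>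
  have transfer: "integrable M (\<lambda>\<omega>. g (X i \<omega>, Y i \<omega>))" "expectation (\<lambda>\<omega>. g (X i \<omega>, Y i \<omega>)) = c"
    if "has_bochner_integral ?P h c" "\<And>z. g (T z) = h z" "g \<in> borel_measurable (borel \<Otimes>\<^sub>M borel)"
    for g h :: "real \<times> real \<Rightarrow> real" and c i
  proof -
    have g: "g \<in> borel_measurable borel"
      using that(3) by (simp add: borel_prod)
    have "has_bochner_integral (distr M borel (\<lambda>\<omega>. (X i \<omega>, Y i \<omega>))) g c"
      unfolding dist using that(1,2)
      by (simp add: has_bochner_integral_iff integrable_distr_eq[OF T g] integral_distr[OF T g])
    then show "integrable M (\<lambda>\<omega>. g (X i \<omega>, Y i \<omega>))" "expectation (\<lambda>\<omega>. g (X i \<omega>, Y i \<omega>)) = c"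
      by (auto simp: has_bochner_integral_iff integrable_distr_eq[OF XY g] integral_distr[OF XY g])
  qed
  note moments = std_normal_pair_linear_moments
  have X1: "expectation (\<lambda>\<omega>. X i \<omega> - mx) = 0" for i
    using transfer(2)[OF moments(1)[of a1 a2], of "\<lambda>p. fst p - mx"] by (auto simp: T_def)
  have X2: "integrable M (\<lambda>\<omega>. (X i \<omega> - mx)\<^sup>2)" "expectation (\<lambda>\<omega>. (X i \<omega> - mx)\<^sup>2) = a1 * a1 + a2 * a2" for i
    using transfer[OF moments(2)[of a1 a2 a1 a2], of "\<lambda>p. (fst p - mx)\<^sup>2"]
    by (auto simp: T_def power2_eq_square)
  have Y1: "expectation (\<lambda>\<omega>. Y i \<omega> - my) = 0" for i
    using transfer(2)[OF moments(1)[of b1 b2], of "\<lambda>p. snd p - my"] by (auto simp: T_def)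
  have Y2: "integrable M (\<lambda>\<omega>. (Y i \<omega> - my)\<^sup>2)" "expectation (\<lambda>\<omega>. (Y i \<omega> - my)\<^sup>2) = b1 * b1 + b2 * b2" for i
    using transfer[OF moments(2)[of b1 b2 b1 b2], of "\<lambda>p. (snd p - my)\<^sup>2"]
    by (auto simp: T_def power2_eq_square)
  let ?Z = "\<lambda>i \<omega>. (Y i \<omega> - my) * (X i \<omega> - mx)"
  have Z1: "integrable M (?Z i)" "expectation (?Z i) = a1 * b1 + a2 * b2" for i
    using transfer[OF moments(2)[of a1 a2 b1 b2], of "\<lambda>p. (snd p - my) * (fst p - mx)"]
    by (auto simp: T_def mult.commute)
  have Z2: "integrable M (\<lambda>\<omega>. (?Z i \<omega>)\<^sup>2)"
    "expectation (\<lambda>\<omega>. (?Z i \<omega>)\<^sup>2) = (a1\<^sup>2 + a2\<^sup>2) * (b1\<^sup>2 + b2\<^sup>2) + 2 * (a1 * b1 + a2 * b2)\<^sup>2" for i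
    using transfer[OF moments(3)[of a1 a2 b1 b2], of "\<lambda>p. ((snd p - my) * (fst p - mx))\<^sup>2"]
    by (auto simp: T_def mult.commute)
  \<comment> \<open>Subtracting the squared mean removes one of the two copies of
    \<open>(a1 * b1 + a2 * b2)\<^sup>2\<close> in the fourth moment.\<close>
  have "variance (?Z i) = v" for i
    using variance_eq[OF Z1(1) Z2(1)] by (simp add: Z1 Z2 v_def)
  then show ?thesis
    using sample_covariance_central_limit[OF indep dist X1 X2 Y1 Y2 Z1(2) Z2(1) _ v] by simp
qed

section \<open>The gamma distribution\<close>

text \<open>\<open>a\<close> is the shape and \<open>b\<close> the scale, not the rate. With shape
  \<open>\<nu> / 2\<close> and scale \<open>2 * \<gamma>1\<close> it is the law of
  \<open>\<gamma>1\<close> times a chi-square variable with \<nu> degrees of freedom.\<close>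

definition gamma_density :: "real \<Rightarrow> real \<Rightarrow> real \<Rightarrow> real" where
  "gamma_density a b x = (if x > 0 then x powr (a - 1) * exp (- x / b) / (Gamma a * b powr a) else 0)"

lemma gamma_density_nonneg: "a > 0 \<Longrightarrow> gamma_density a b x \<ge> 0"
  by (simp add: gamma_density_def Gamma_real_pos less_imp_le)

lemma borel_measurable_gamma_density [measurable]: "gamma_density a b \<in> borel_measurable borel"
  unfolding gamma_density_def[abs_def] by measurable

lemma nn_integral_gamma_density:
  assumes "a > 0" "b > 0"
  shows "(\<integral>\<^sup>+x. ennreal (gamma_density a b x) \<partial>lborel) = 1"
proof -
  have G: "Gamma a > 0" by (rule Gamma_real_pos) fact
  \<comment> \<open>The substitution x = b t leads to Euler's integral. At t = 0 the indicator is 1,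
    but \<open>0 powr (a - 1) = 0\<close> agrees with the density there.\<close>
  have eq: "b * gamma_density a b (0 + b * t) = inverse (Gamma a) * (indicator {0..} t * t powr (a - 1) / exp t)" for t
    using assms G
    by (auto simp: gamma_density_def zero_less_mult_iff powr_mult exp_minus powr_diff divide_simps
        split: split_indicator)
  have "(\<integral>\<^sup>+x. ennreal (gamma_density a b x) \<partial>lborel)
      = \<bar>b\<bar> * (\<integral>\<^sup>+t. ennreal (gamma_density a b (0 + b * t)) \<partial>lborel)"
    using assms by (intro nn_integral_real_affine) auto
  also have "\<dots> = (\<integral>\<^sup>+t. ennreal (b * gamma_density a b (0 + b * t)) \<partial>lborel)"
    using assms by (subst nn_integral_cmult[symmetric]) (auto simp: ennreal_mult' gamma_density_nonneg)
  also have "\<dots> = inverse (Gamma a) * (\<integral>\<^sup>+t. ennreal (indicator {0..} t * t powr (a - 1) / exp t) \<partial>lborel)"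
    unfolding eq using G by (subst nn_integral_cmult[symmetric]) (auto simp: ennreal_mult'[symmetric])
  also have "\<dots> = 1"
    using G by (simp add: Gamma_conv_nn_integral_real[OF assms(1), symmetric] ennreal_mult[symmetric])
  finally show ?thesis .
qed

lemma prob_space_gamma_density:
  "a > 0 \<Longrightarrow> b > 0 \<Longrightarrow> prob_space (density lborel (gamma_density a b))"
  by (intro prob_spaceI) (simp add: emeasure_density nn_integral_gamma_density)

text \<open>Multiplying by x^p raises the shape from \<open>a\<close> to \<open>a + p\<close> up to
  the constant \<open>?C\<close>, and the new density has integral 1. As the density lives on x > 0,
  \<open>f\<close> has to be the power only there, which admits the identity, squares and
  \<open>sqrt\<close> directly.\<close>

lemma has_bochner_integral_gamma_density_powr:
  assumes ab: "a > 0" "b > 0" and p: "p \<ge> 0" and [measurable]: "f \<in> borel_measurable borel"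
    and f: "\<And>x. x > 0 \<Longrightarrow> f x = x powr p"
  shows "has_bochner_integral (density lborel (gamma_density a b)) f (b powr p * Gamma (a + p) / Gamma a)"
proof -
  have ap: "a + p > 0" using ab p by simp
  let ?C = "b powr p * Gamma (a + p) / Gamma a"
  have G: "Gamma a > 0" "Gamma (a + p) > 0" using ab ap by (auto intro: Gamma_real_pos)
  have eq: "gamma_density a b x * f x = ?C * gamma_density (a + p) b x" for x
  proof (cases "x > 0")
    case True
    have "x powr (a + p - 1) = x powr (a - 1) * x powr p"
      by (simp flip: powr_add add: algebra_simps)
    then show ?thesis
      using True ab G by (simp add: gamma_density_def f powr_add)
  qed (simp add: gamma_density_def)
  have "has_bochner_integral lborel (gamma_density (a + p) b) 1"
    by (rule has_bochner_integral_nn_integral)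
      (auto simp: gamma_density_nonneg[OF ap] nn_integral_gamma_density ap ab)
  from has_bochner_integral_mult_right[OF this, of ?C]
  have "has_bochner_integral lborel (\<lambda>x. gamma_density a b x *\<^sub>R f x) ?C"
    by (simp add: eq)
  then show ?thesis
    by (intro has_bochner_integral_density) (auto simp: gamma_density_nonneg ab)
qed

section \<open>The bivariate Wishart law: factorization, marginals and moments\<close>

lemma bivariate_wishart_density_commute:
  "bivariate_wishart_density \<nu> \<gamma>1 \<gamma>2 \<gamma>3 (s, t, r) = bivariate_wishart_density \<nu> \<gamma>2 \<gamma>1 \<gamma>3 (t, s, r)"
  by (simp add: bivariate_wishart_density_def mult.commute add.commute conj_ac)

text \<open>Given \<open>s\<close>, completing the square in \<open>r\<close> makes \<open>r\<close> normal and the Schur complement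
  \<open>w = t - r\<^sup>2 / s\<close> gamma distributed, independently of \<open>(s, r)\<close>: the Bartlett decomposition.\<close>

lemma bivariate_wishart_density_factor:
  fixes \<gamma>1 \<gamma>2 \<gamma>3 \<nu> s r w :: real
  defines "\<Delta> \<equiv> \<gamma>1 * \<gamma>2 - \<gamma>3\<^sup>2"
  assumes \<gamma>: "\<gamma>1 > 0" "\<gamma>1 * \<gamma>2 > \<gamma>3\<^sup>2" and \<nu>: "\<nu> > 2" and s: "s > 0"
  shows "bivariate_wishart_density \<nu> \<gamma>1 \<gamma>2 \<gamma>3 (s, r\<^sup>2 / s + w, r) =
    gamma_density (\<nu> / 2) (2 * \<gamma>1) s * normal_density (\<gamma>3 / \<gamma>1 * s) (sqrt (\<Delta> / \<gamma>1 * s)) r *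
    gamma_density ((\<nu> - 1) / 2) (2 * \<Delta> / \<gamma>1) w"
proof (cases "w > 0")
  \<comment> \<open>Here \<open>s * t - r\<^sup>2 = s * w\<close> is not positive, so the point lies
    outside the support and both sides are 0.\<close>
  case False
  then have "\<not> r\<^sup>2 < s * (r\<^sup>2 / s + w)"
    using s by (simp add: distrib_left zero_less_mult_iff)
  then show ?thesis
    using False by (simp add: bivariate_wishart_density_def gamma_density_def)
next
  case w: True
  have \<Delta>: "\<Delta> > 0" using \<gamma> by (simp add: \<Delta>_def)
  have \<gamma>2: "\<gamma>2 = (\<Delta> + \<gamma>3\<^sup>2) / \<gamma>1"
    using \<gamma> by (simp add: \<Delta>_def)
  have st: "s * (r\<^sup>2 / s + w) - r\<^sup>2 = s * w" "r\<^sup>2 < s * (r\<^sup>2 / s + w)"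
    using s w by (simp_all add: distrib_left)
  have pos: "r\<^sup>2 / s + w > 0"
    using s w by (intro add_nonneg_pos) auto
  \<comment> \<open>Over the denominator \<open>2 * \<Delta>\<close> stands
    \<open>\<gamma>2 * s + \<gamma>1 * t - 2 * \<gamma>3 * r\<close>. Completing the square in r
    leaves \<open>(\<gamma>2 - \<gamma>3\<^sup>2 / \<gamma>1) * s = \<Delta> / \<gamma>1 *
    s\<close>, hence the rate \<open>1 / (2 * \<gamma>1)\<close> for s.\<close>
  have e: "- (\<gamma>1 * \<gamma>2) / (2 * \<Delta>) * (s / \<gamma>1 + (r\<^sup>2 / s + w) / \<gamma>2 - 2 * \<gamma>3 * r / (\<gamma>1 * \<gamma>2))
      = - s / (2 * \<gamma>1) + - (r - \<gamma>3 / \<gamma>1 * s)\<^sup>2 / (2 * (\<Delta> / \<gamma>1 * s)) + - w / (2 * \<Delta> / \<gamma>1)"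
  proof -
    have "\<gamma>1 * \<gamma>2 > 0" using \<gamma>(2) zero_le_power2[of \<gamma>3] by linarith
    then have "\<gamma>2 > 0" using \<gamma>(1) by (simp add: zero_less_mult_iff)
    then have "- (\<gamma>1 * \<gamma>2) / (2 * \<Delta>) * (s / \<gamma>1 + (r\<^sup>2 / s + w) / \<gamma>2 - 2 * \<gamma>3 * r / (\<gamma>1 * \<gamma>2))
      = - (\<gamma>2 * s + \<gamma>1 * (r\<^sup>2 / s + w) - 2 * \<gamma>3 * r) / (2 * \<Delta>)"
      using \<gamma> \<Delta> by (simp add: field_simps)
    also have "\<dots> = - s / (2 * \<gamma>1) + - (r - \<gamma>3 / \<gamma>1 * s)\<^sup>2 / (2 * (\<Delta> / \<gamma>1 * s)) + - w / (2 * \<Delta> / \<gamma>1)"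
      unfolding \<gamma>2 using \<gamma> \<Delta> s by (simp add: field_simps power2_eq_square)
    finally show ?thesis .
  qed
  \<comment> \<open>All bases are positive, so both sides are written as exponentials and the claim
    becomes an identity linear in the logarithms of 2, \<pi>, \<Delta>, \<gamma>1, s and w.\<close>
  have c: "\<Delta> powr (- \<nu> / 2) / (2 powr \<nu> * sqrt pi) * (s * w) powr ((\<nu> - 3) / 2)
      = s powr (\<nu> / 2 - 1) / (2 * \<gamma>1) powr (\<nu> / 2) * (1 / sqrt (2 * pi * (\<Delta> / \<gamma>1 * s)))
        * (w powr ((\<nu> - 1) / 2 - 1) / (2 * \<Delta> / \<gamma>1) powr ((\<nu> - 1) / 2))"
  proof -
    have sq: "sqrt x = exp (ln x / 2)" if "x > 0" for x
      using that by (simp add: powr_half_sqrt[symmetric] powr_def)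
    have pw: "x powr p = exp (p * ln x)" if "x > 0" for x p :: real
      using that by (simp add: powr_def)
    have ln: "ln (s * w) = ln s + ln w" "ln (2 * \<gamma>1) = ln 2 + ln \<gamma>1"
      "ln (2 * \<Delta> / \<gamma>1) = ln 2 + ln \<Delta> - ln \<gamma>1"
      "ln (2 * pi * (\<Delta> / \<gamma>1 * s)) = ln 2 + ln pi + ln \<Delta> - ln \<gamma>1 + ln s"
      using \<gamma>(1) \<Delta> s w by (simp_all add: ln_mult ln_div)
    have "2 * \<gamma>1 > 0" "2 * \<Delta> / \<gamma>1 > 0" "2 * pi * (\<Delta> / \<gamma>1 * s) > 0" "s * w > 0"
      using \<gamma>(1) \<Delta> s w by simp_all
    note pos = this
    have inv: "1 / exp x = exp (- x)" for x :: real
      by (simp add: exp_minus inverse_eq_divide)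
    show ?thesis
      unfolding sq[OF pos(3)] sq[OF pi_gt_zero] pw[OF pos(1)] pw[OF pos(2)] pw[OF pos(4)] pw[OF \<Delta>]
        pw[OF s] pw[OF w] pw[OF zero_less_numeral] ln inv mult_exp_exp exp_diff[symmetric]
      by (rule arg_cong[where f = exp]) (simp add: field_simps)
  qed
  have n: "normal_density (\<gamma>3 / \<gamma>1 * s) (sqrt (\<Delta> / \<gamma>1 * s)) r
      = 1 / sqrt (2 * pi * (\<Delta> / \<gamma>1 * s)) * exp (- (r - \<gamma>3 / \<gamma>1 * s)\<^sup>2 / (2 * (\<Delta> / \<gamma>1 * s)))"
    using \<gamma> \<Delta> s by (simp add: normal_density_def)
  have "bivariate_wishart_density \<nu> \<gamma>1 \<gamma>2 \<gamma>3 (s, r\<^sup>2 / s + w, r) =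
      (\<Delta> powr (- \<nu> / 2) / (2 powr \<nu> * sqrt pi) * (s * w) powr ((\<nu> - 3) / 2))
      / (Gamma (\<nu> / 2) * Gamma ((\<nu> - 1) / 2))
      * exp (- (\<gamma>1 * \<gamma>2) / (2 * \<Delta>) * (s / \<gamma>1 + (r\<^sup>2 / s + w) / \<gamma>2 - 2 * \<gamma>3 * r / (\<gamma>1 * \<gamma>2)))"
    unfolding bivariate_wishart_density_def prod.case st(1) \<Delta>_def using s pos st by simp
  also have "\<dots> = gamma_density (\<nu> / 2) (2 * \<gamma>1) s * normal_density (\<gamma>3 / \<gamma>1 * s) (sqrt (\<Delta> / \<gamma>1 * s)) r *
    gamma_density ((\<nu> - 1) / 2) (2 * \<Delta> / \<gamma>1) w"
    unfolding c e n exp_add gamma_density_def using s w by (simp add: mult_ac)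
  finally show ?thesis .
qed

text \<open>After the shift t = r^2 / s + w, which has Jacobian 1, the factor in w is a probability
  density and integrates to 1. What is left is the joint density of (s, r).\<close>

lemma nn_integral_bivariate_wishart_density_t:
  fixes \<gamma>1 \<gamma>2 \<gamma>3 \<nu> s r :: real
  defines "\<Delta> \<equiv> \<gamma>1 * \<gamma>2 - \<gamma>3\<^sup>2"
  assumes \<gamma>: "\<gamma>1 > 0" "\<gamma>1 * \<gamma>2 > \<gamma>3\<^sup>2" and \<nu>: "\<nu> > 2"
    and meas: "(\<lambda>t. bivariate_wishart_density \<nu> \<gamma>1 \<gamma>2 \<gamma>3 (s, t, r)) \<in> borel_measurable borel"
  shows "(\<integral>\<^sup>+t. ennreal (bivariate_wishart_density \<nu> \<gamma>1 \<gamma>2 \<gamma>3 (s, t, r)) \<partial>lborel) =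
    ennreal (gamma_density (\<nu> / 2) (2 * \<gamma>1) s * normal_density (\<gamma>3 / \<gamma>1 * s) (sqrt (\<Delta> / \<gamma>1 * s)) r)"
proof (cases "s > 0")
  case False
  then show ?thesis by (simp add: bivariate_wishart_density_def gamma_density_def)
next
  case True
  let ?K = "gamma_density (\<nu> / 2) (2 * \<gamma>1) s * normal_density (\<gamma>3 / \<gamma>1 * s) (sqrt (\<Delta> / \<gamma>1 * s)) r"
  have "(\<integral>\<^sup>+t. ennreal (bivariate_wishart_density \<nu> \<gamma>1 \<gamma>2 \<gamma>3 (s, t, r)) \<partial>lborel)
      = (\<integral>\<^sup>+w. ennreal (bivariate_wishart_density \<nu> \<gamma>1 \<gamma>2 \<gamma>3 (s, r\<^sup>2 / s + w, r)) \<partial>lborel)"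
    using meas nn_integral_real_affine[of "\<lambda>t. ennreal (bivariate_wishart_density \<nu> \<gamma>1 \<gamma>2 \<gamma>3 (s, t, r))" 1 "r\<^sup>2 / s"]
    by simp
  also have "\<dots> = (\<integral>\<^sup>+w. ennreal ?K * ennreal (gamma_density ((\<nu> - 1) / 2) (2 * \<Delta> / \<gamma>1) w) \<partial>lborel)"
    unfolding bivariate_wishart_density_factor[OF \<gamma> \<nu> True, folded \<Delta>_def]
    using \<nu> by (intro nn_integral_cong ennreal_mult mult_nonneg_nonneg gamma_density_nonneg) auto
  also have "\<dots> = ennreal ?K"
    using \<gamma> \<nu> by (subst nn_integral_cmult) (auto simp: nn_integral_gamma_density \<Delta>_def)
  finally show ?thesis .
qed

lemma (in prob_space) bivariate_wishart_marginal_eq_distr: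
  fixes \<gamma>1 \<gamma>2 \<gamma>3 \<nu> :: real
  defines "\<Delta> \<equiv> \<gamma>1 * \<gamma>2 - \<gamma>3\<^sup>2"
  assumes \<gamma>: "\<gamma>1 > 0" "\<gamma>1 * \<gamma>2 > \<gamma>3\<^sup>2" and \<nu>: "\<nu> > 2"
    and D: "distributed M lborel \<Theta> (\<lambda>z. ennreal (bivariate_wishart_density \<nu> \<gamma>1 \<gamma>2 \<gamma>3 z))"
  shows "distr M borel (\<lambda>\<omega>. (fst (\<Theta> \<omega>), snd (snd (\<Theta> \<omega>)))) =
    distr (density lborel (gamma_density (\<nu> / 2) (2 * \<gamma>1)) \<Otimes>\<^sub>M std_normal_distribution) borel
      (\<lambda>(s, v). (s, \<gamma>3 / \<gamma>1 * s + sqrt (\<Delta> / \<gamma>1 * s) * v))"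
    (is "distr M borel ?S = distr ?P borel ?T")
proof (rule measure_eqI)
  let ?N = std_normal_distribution and ?f = "bivariate_wishart_density \<nu> \<gamma>1 \<gamma>2 \<gamma>3"
  let ?g = "gamma_density (\<nu> / 2) (2 * \<gamma>1)" and ?m = "\<lambda>s. \<gamma>3 / \<gamma>1 * s" and ?s = "\<lambda>s. sqrt (\<Delta> / \<gamma>1 * s)"
  interpret N: sigma_finite_measure ?N by (rule sigma_finite_std_normal_distribution)
  \<comment> \<open>\<open>ennreal\<close> cuts off negative values, so measurability of the real
    density is recovered from \<open>distributed\<close> through its nonnegativity.\<close>
  have nonneg: "?f z \<ge> 0" for z
    using \<nu> by (cases z) (auto simp: bivariate_wishart_density_def intro!: divide_nonneg_nonneg mult_nonneg_nonneg
      less_imp_le[OF Gamma_real_pos])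
  have \<Theta> [measurable]: "\<Theta> \<in> M \<rightarrow>\<^sub>M borel"
    using distributed_measurable[OF D] by simp
  have f: "?f \<in> borel_measurable borel"
    using distributed_real_measurable[OF _ D] nonneg by simp
  then have [measurable]: "?f \<in> borel_measurable (lborel \<Otimes>\<^sub>M (lborel \<Otimes>\<^sub>M lborel))"
    by (simp add: lborel_prod)
  have \<Theta>' [measurable]: "\<Theta> \<in> M \<rightarrow>\<^sub>M (borel \<Otimes>\<^sub>M (borel \<Otimes>\<^sub>M borel))"
    using \<Theta> by (simp add: borel_prod)
  have S [measurable]: "?S \<in> M \<rightarrow>\<^sub>M borel"
    by (simp flip: borel_prod)
  have T [measurable]: "?T \<in> ?P \<rightarrow>\<^sub>M borel"
    by (simp flip: borel_prod)
  fix A assume "A \<in> sets (distr M borel ?S)"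
  then have A: "A \<in> sets borel" and [measurable]: "A \<in> sets (borel \<Otimes>\<^sub>M borel)"
    unfolding borel_prod by auto
  have ind [measurable]: "(\<lambda>z. indicator A (fst z, snd (snd z)) :: ennreal) \<in> borel_measurable (lborel \<Otimes>\<^sub>M (lborel \<Otimes>\<^sub>M lborel))"
    by measurable
  have F: "(\<lambda>z. ennreal (?f z) * indicator A (fst z, snd (snd z))) \<in> borel_measurable (lborel \<Otimes>\<^sub>M (lborel \<Otimes>\<^sub>M lborel))"
    by measurable
  have sf: "sigma_finite_measure (lborel \<Otimes>\<^sub>M lborel :: (real \<times> real) measure)"
    by (simp add: lborel_prod lborel.sigma_finite_measure_axioms)
  have "emeasure (distr M borel ?S) A = (\<integral>\<^sup>+\<omega>. indicator A (?S \<omega>) \<partial>M)"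
    using A by (subst nn_integral_distr[OF S, symmetric]) auto
  also have "\<dots> = (\<integral>\<^sup>+z. ennreal (?f z) * indicator A (fst z, snd (snd z)) \<partial>lborel)"
    using distributed_nn_integral[OF D, of "\<lambda>z. indicator A (fst z, snd (snd z))", symmetric] ind
    by (simp add: lborel_prod)
  also have "\<dots> = (\<integral>\<^sup>+z. ennreal (?f z) * indicator A (fst z, snd (snd z)) \<partial>(lborel \<Otimes>\<^sub>M (lborel \<Otimes>\<^sub>M lborel)))"
    by (simp add: lborel_prod)
  also have "\<dots> = (\<integral>\<^sup>+s. \<integral>\<^sup>+z. ennreal (?f (s, z)) * indicator A (s, snd z) \<partial>(lborel \<Otimes>\<^sub>M lborel) \<partial>lborel)"
    using sigma_finite_measure.nn_integral_fst[OF sf F] by simp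
  \<comment> \<open>Tonelli puts t innermost, where the indicator is constant and t can be
    integrated out.\<close>
  also have "\<dots> = (\<integral>\<^sup>+s. \<integral>\<^sup>+r. \<integral>\<^sup>+t. ennreal (?f (s, t, r)) * indicator A (s, r) \<partial>lborel \<partial>lborel \<partial>lborel)"
    by (subst lborel_pair.nn_integral_snd[symmetric]) auto
  also have "\<dots> = (\<integral>\<^sup>+s. \<integral>\<^sup>+r. ennreal (?g s) * (ennreal (normal_density (?m s) (?s s) r) * indicator A (s, r)) \<partial>lborel \<partial>lborel)"
    using \<nu> by (simp add: nn_integral_multc nn_integral_bivariate_wishart_density_t[OF \<gamma> \<nu>, folded \<Delta>_def]
        ennreal_mult gamma_density_nonneg mult.assoc)
  also have "\<dots> = (\<integral>\<^sup>+s. ennreal (?g s) * (\<integral>\<^sup>+r. ennreal (normal_density (?m s) (?s s) r) * indicator A (s, r) \<partial>lborel) \<partial>lborel)"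
    by (subst nn_integral_cmult) auto
  also have "\<dots> = (\<integral>\<^sup>+s. ennreal (?g s) * (\<integral>\<^sup>+v. indicator A (s, ?m s + ?s s * v) \<partial>?N) \<partial>lborel)"
  proof (intro nn_integral_cong)
    fix s
    show "ennreal (?g s) * (\<integral>\<^sup>+r. ennreal (normal_density (?m s) (?s s) r) * indicator A (s, r) \<partial>lborel)
        = ennreal (?g s) * (\<integral>\<^sup>+v. indicator A (s, ?m s + ?s s * v) \<partial>?N)"
    \<comment> \<open>Standardizing r needs a positive standard deviation \<open>?s s\<close>; for s
      not positive the factor \<open>?g s\<close> is 0.\<close>
    proof (cases "s > 0")
      case True
      then have "?s s > 0" using \<gamma> by (simp add: \<Delta>_def)
      then show ?thesis
        by (subst nn_integral_normal_density_affine) auto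
    qed (simp add: gamma_density_def)
  qed
  also have "\<dots> = (\<integral>\<^sup>+s. \<integral>\<^sup>+v. indicator A (?T (s, v)) \<partial>?N \<partial>density lborel ?g)"
    by (subst nn_integral_density) auto
  also have "\<dots> = (\<integral>\<^sup>+z. indicator A (?T z) \<partial>?P)"
    by (rule N.nn_integral_fst) (use A in measurable)
  also have "\<dots> = (\<integral>\<^sup>+z. indicator A z \<partial>distr ?P borel ?T)"
    by (rule nn_integral_distr[symmetric]) (use A in measurable)
  also have "\<dots> = emeasure (distr ?P borel ?T) A"
    using A by simp
  finally show "emeasure (distr M borel ?S) A = emeasure (distr ?P borel ?T) A" .
qed simp

lemma nn_integral_lborel_swap_triple:
  fixes F :: "real \<times> real \<times> real \<Rightarrow> ennreal"
  assumes F: "F \<in> borel_measurable borel"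
  shows "(\<integral>\<^sup>+(s, t, r). F (t, s, r) \<partial>lborel) = (\<integral>\<^sup>+z. F z \<partial>lborel)"
proof -
  have sf: "sigma_finite_measure (lborel \<Otimes>\<^sub>M lborel :: (real \<times> real) measure)"
    by (simp add: lborel_prod lborel.sigma_finite_measure_axioms)
  have [measurable]: "F \<in> borel_measurable (lborel \<Otimes>\<^sub>M (lborel \<Otimes>\<^sub>M lborel))"
    using F by (simp add: lborel_prod)
  have iter: "(\<integral>\<^sup>+z. G z \<partial>lborel) = (\<integral>\<^sup>+s. \<integral>\<^sup>+t. \<integral>\<^sup>+r. G (s, t, r) \<partial>lborel \<partial>lborel \<partial>lborel)"
    if [measurable]: "G \<in> borel_measurable (lborel \<Otimes>\<^sub>M (lborel \<Otimes>\<^sub>M lborel))"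
    for G :: "real \<times> real \<times> real \<Rightarrow> ennreal"
  proof -
    have "(\<integral>\<^sup>+z. G z \<partial>lborel) = (\<integral>\<^sup>+z. G z \<partial>(lborel \<Otimes>\<^sub>M (lborel \<Otimes>\<^sub>M lborel)))"
      by (simp add: lborel_prod)
    also have "\<dots> = (\<integral>\<^sup>+s. \<integral>\<^sup>+z. G (s, z) \<partial>(lborel \<Otimes>\<^sub>M lborel) \<partial>lborel)"
      using sigma_finite_measure.nn_integral_fst[OF sf that] by simp
    also have "\<dots> = (\<integral>\<^sup>+s. \<integral>\<^sup>+t. \<integral>\<^sup>+r. G (s, t, r) \<partial>lborel \<partial>lborel \<partial>lborel)"
      by (subst lborel.nn_integral_fst[symmetric]) auto
    finally show ?thesis .
  qed
  have "(\<integral>\<^sup>+(s, t, r). F (t, s, r) \<partial>lborel) = (\<integral>\<^sup>+s. \<integral>\<^sup>+t. \<integral>\<^sup>+r. F (t, s, r) \<partial>lborel \<partial>lborel \<partial>lborel)"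
    by (subst iter) auto
  also have "\<dots> = (\<integral>\<^sup>+t. \<integral>\<^sup>+s. \<integral>\<^sup>+r. F (t, s, r) \<partial>lborel \<partial>lborel \<partial>lborel)"
    by (rule lborel_pair.Fubini') measurable
  also have "\<dots> = (\<integral>\<^sup>+z. F z \<partial>lborel)"
    by (subst iter) auto
  finally show ?thesis .
qed

text \<open>Exchanging two coordinates preserves Lebesgue measure, and the density is invariant when
  \<gamma>1 and \<gamma>2 are exchanged along with s and t.\<close>

lemma distributed_bivariate_wishart_swap:
  assumes D: "distributed M lborel \<Theta> (\<lambda>z. ennreal (bivariate_wishart_density \<nu> \<gamma>1 \<gamma>2 \<gamma>3 z))"
  shows "distributed M lborel (\<lambda>\<omega>. case \<Theta> \<omega> of (s, t, r) \<Rightarrow> (t, s, r))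
    (\<lambda>z. ennreal (bivariate_wishart_density \<nu> \<gamma>2 \<gamma>1 \<gamma>3 z))"
proof -
  let ?f = "\<lambda>z. ennreal (bivariate_wishart_density \<nu> \<gamma>1 \<gamma>2 \<gamma>3 z)"
  let ?h = "\<lambda>z. ennreal (bivariate_wishart_density \<nu> \<gamma>2 \<gamma>1 \<gamma>3 z)"
  let ?w = "\<lambda>(s, t, r). (t, s, r) :: real \<times> real \<times> real"
  have w [measurable]: "?w \<in> borel \<rightarrow>\<^sub>M borel"
    by (simp flip: borel_prod)
  have f [measurable]: "?f \<in> borel_measurable borel"
    using distributed_borel_measurable[OF D] by simp
  have \<Theta> [measurable]: "\<Theta> \<in> M \<rightarrow>\<^sub>M borel"
    using distributed_measurable[OF D] by simp
  have h_eq: "?h = (\<lambda>z. ?f (?w z))"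
    using bivariate_wishart_density_commute by (auto simp: fun_eq_iff)
  have h [measurable]: "?h \<in> borel_measurable borel"
    unfolding h_eq by measurable
  have "distr M lborel (\<lambda>\<omega>. ?w (\<Theta> \<omega>)) = density lborel ?h"
  proof (rule measure_eqI)
    fix A assume "A \<in> sets (distr M lborel (\<lambda>\<omega>. ?w (\<Theta> \<omega>)))"
    then have A [measurable]: "A \<in> sets borel" by simp
    have m: "(\<lambda>\<omega>. ?w (\<Theta> \<omega>)) \<in> M \<rightarrow>\<^sub>M lborel"
      by (simp add: measurable_compose[OF \<Theta> w])
    have "emeasure (distr M lborel (\<lambda>\<omega>. ?w (\<Theta> \<omega>))) A = (\<integral>\<^sup>+\<omega>. indicator A (?w (\<Theta> \<omega>)) \<partial>M)"
      using A by (subst nn_integral_distr[OF m, symmetric]) auto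
    also have "\<dots> = (\<integral>\<^sup>+z. ?f z * indicator A (?w z) \<partial>lborel)"
      by (rule distributed_nn_integral[OF D, symmetric]) (use A w in measurable)
    also have "\<dots> = (\<integral>\<^sup>+(s, t, r). ?h (t, s, r) * indicator A (t, s, r) \<partial>lborel)"
      by (intro nn_integral_cong) (auto simp: bivariate_wishart_density_commute[of \<nu> \<gamma>1])
    also have "\<dots> = (\<integral>\<^sup>+z. ?h z * indicator A z \<partial>lborel)"
      by (rule nn_integral_lborel_swap_triple[of "\<lambda>z. ?h z * indicator A z"]) measurable
    also have "\<dots> = emeasure (density lborel ?h) A"
      using A h by (simp add: emeasure_density)
    finally show "emeasure (distr M lborel (\<lambda>\<omega>. ?w (\<Theta> \<omega>))) A = emeasure (density lborel ?h) A" .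
  qed simp
  then show ?thesis
    unfolding distributed_def using h measurable_compose[OF \<Theta> w] by simp
qed

text \<open>With c = \<gamma>3 / \<gamma>1 and d = (\<gamma>1 \<gamma>2 - \<gamma>3^2) / \<gamma>1,
  the representation r = c s + sqrt(d s) v gives E(r) = c E(s) and Var(r) = c^2 Var(s) + d
  E(s).\<close>

lemma (in prob_space) bivariate_wishart_moments:
  fixes \<gamma>1 \<gamma>2 \<gamma>3 \<nu> :: real
  assumes \<gamma>: "\<gamma>1 > 0" "\<gamma>1 * \<gamma>2 > \<gamma>3\<^sup>2" and \<nu>: "\<nu> > 2"
    and D: "distributed M lborel \<Theta> (\<lambda>z. ennreal (bivariate_wishart_density \<nu> \<gamma>1 \<gamma>2 \<gamma>3 z))"
  shows "integrable M (\<lambda>\<omega>. (fst (\<Theta> \<omega>))\<^sup>2)"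
    and "expectation (\<lambda>\<omega>. fst (\<Theta> \<omega>)) = \<nu> * \<gamma>1"
    and "variance (\<lambda>\<omega>. fst (\<Theta> \<omega>)) = \<nu> * (2 * \<gamma>1\<^sup>2)"
    and "integrable M (\<lambda>\<omega>. (snd (snd (\<Theta> \<omega>)))\<^sup>2)"
    and "expectation (\<lambda>\<omega>. snd (snd (\<Theta> \<omega>))) = \<nu> * \<gamma>3"
    and "variance (\<lambda>\<omega>. snd (snd (\<Theta> \<omega>))) = \<nu> * (\<gamma>1 * \<gamma>2 + \<gamma>3\<^sup>2)"
proof -
  let ?a = "\<nu> / 2" and ?b = "2 * \<gamma>1"
  let ?G = "density lborel (gamma_density ?a ?b)" and ?N = std_normal_distribution
  let ?P = "?G \<Otimes>\<^sub>M ?N"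
  define c d where "c = \<gamma>3 / \<gamma>1" and "d = (\<gamma>1 * \<gamma>2 - \<gamma>3\<^sup>2) / \<gamma>1"
  let ?T = "\<lambda>(s, v). (s, c * s + sqrt (d * s) * v)"
  have d: "d > 0" using \<gamma> by (simp add: d_def)
  have ab: "?a > 0" "?b > 0" using \<gamma> \<nu> by auto
  have law: "distr M borel (\<lambda>\<omega>. (fst (\<Theta> \<omega>), snd (snd (\<Theta> \<omega>)))) = distr ?P borel ?T"
    using bivariate_wishart_marginal_eq_distr[OF \<gamma> \<nu> D] by (simp add: c_def d_def)
  have \<Theta> [measurable]: "\<Theta> \<in> M \<rightarrow>\<^sub>M borel \<Otimes>\<^sub>M (borel \<Otimes>\<^sub>M borel)"
    using distributed_measurable[OF D] by (simp add: borel_prod)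
  have S: "(\<lambda>\<omega>. (fst (\<Theta> \<omega>), snd (snd (\<Theta> \<omega>)))) \<in> M \<rightarrow>\<^sub>M borel"
    by (simp flip: borel_prod)
  have T: "?T \<in> ?P \<rightarrow>\<^sub>M borel"
    by (simp flip: borel_prod)
  have transfer: "integrable M (\<lambda>\<omega>. g (fst (\<Theta> \<omega>), snd (snd (\<Theta> \<omega>)))) \<and>
      expectation (\<lambda>\<omega>. g (fst (\<Theta> \<omega>), snd (snd (\<Theta> \<omega>)))) = m"
    if "has_bochner_integral ?P h m" "\<And>z. g (?T z) = h z" "g \<in> borel_measurable (borel \<Otimes>\<^sub>M borel)"
    for g h :: "real \<times> real \<Rightarrow> real" and m
  proof -
    have g: "g \<in> borel_measurable borel"
      using that(3) by (simp add: borel_prod)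
    have "has_bochner_integral (distr M borel (\<lambda>\<omega>. (fst (\<Theta> \<omega>), snd (snd (\<Theta> \<omega>))))) g m"
      unfolding law using that(1,2)
      by (simp add: has_bochner_integral_iff integrable_distr_eq[OF T g] integral_distr[OF T g])
    then show ?thesis
      by (simp add: has_bochner_integral_iff integrable_distr_eq[OF S g] integral_distr[OF S g])
  qed
  \<comment> \<open>The exponent \<open>p\<close> is real because r contains the square root of s,
    so half-integer powers occur.\<close>
  have pair: "has_bochner_integral ?P (\<lambda>z. k * (f (fst z) * snd z ^ j))
      (k * (?b powr p * Gamma (?a + p) / Gamma ?a * (\<integral>v. v ^ j \<partial>?N)))"
    if "p \<ge> 0" "f \<in> borel_measurable borel" "\<And>x. x > 0 \<Longrightarrow> f x = x powr p" for k f p j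
  proof -
    have "has_bochner_integral ?P (\<lambda>(x, y). f x * y ^ j)
        (?b powr p * Gamma (?a + p) / Gamma ?a * (\<integral>v. v ^ j \<partial>?N))"
      by (intro has_bochner_integral_pair_mult sigma_finite_std_normal_distribution
          prob_space_imp_sigma_finite prob_space_gamma_density
          has_bochner_integral_gamma_density_powr ab that)
        (auto simp: has_bochner_integral_iff integrable_std_normal_distribution_moment)
    from has_bochner_integral_mult_right[OF this[unfolded split_beta']] show ?thesis .
  qed
  have \<Gamma>: "?b powr 1 * Gamma (?a + 1) / Gamma ?a = \<nu> * \<gamma>1"
    "?b powr 2 * Gamma (?a + 2) / Gamma ?a = \<nu> * (\<nu> + 2) * \<gamma>1\<^sup>2"
  proof -
    have G: "Gamma ?a > 0" using ab by (intro Gamma_real_pos) auto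
    have 1: "Gamma (?a + 1) = ?a * Gamma ?a"
      using ab by (intro Gamma_plus1) (auto elim!: nonpos_Ints_cases)
    have "Gamma (?a + 1 + 1) = (?a + 1) * Gamma (?a + 1)"
      using ab by (intro Gamma_plus1) (auto elim!: nonpos_Ints_cases)
    then have 2: "Gamma (?a + 2) = (?a + 1) * ?a * Gamma ?a"
      by (simp add: 1 add.assoc)
    show "?b powr 1 * Gamma (?a + 1) / Gamma ?a = \<nu> * \<gamma>1"
      using G \<gamma> by (simp add: 1)
    show "?b powr 2 * Gamma (?a + 2) / Gamma ?a = \<nu> * (\<nu> + 2) * \<gamma>1\<^sup>2"
      unfolding 2 using G \<gamma> by (simp add: field_simps power2_eq_square)
  qed
  note N = std_normal_moments
  have s1: "has_bochner_integral ?P (\<lambda>z. k * fst z) (k * (\<nu> * \<gamma>1))" for k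
    using pair[of 1 "\<lambda>x. x" k 0, unfolded \<Gamma>(1)] by (simp add: N)
  have s2: "has_bochner_integral ?P (\<lambda>z. k * (fst z)\<^sup>2) (k * (\<nu> * (\<nu> + 2) * \<gamma>1\<^sup>2))" for k
    using pair[of 2 "\<lambda>x. x\<^sup>2" k 0, unfolded \<Gamma>(2)] by (simp add: N)
  \<comment> \<open>For the exponents 1/2 and 3/2 the Gamma quotient need not be evaluated: it is
    multiplied by the first moment of v, which is 0.\<close>
  have v1: "has_bochner_integral ?P (\<lambda>z. k * (sqrt (fst z) * snd z)) 0" for k
    using pair[of "1 / 2" sqrt k 1] by (simp add: N powr_half_sqrt)
  have sv: "has_bochner_integral ?P (\<lambda>z. k * (fst z * sqrt (fst z) * snd z)) 0" for k
  proof -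
    have "x * sqrt x = x powr (3 / 2)" if "x > 0" for x :: real
      using that powr_add[of x 1 "1 / 2"] by (simp add: powr_half_sqrt)
    then show ?thesis
      using pair[of "3 / 2" "\<lambda>x. x * sqrt x" k 1] by (simp add: N)
  qed
  \<comment> \<open>\<open>(sqrt x)\<^sup>2\<close> is not simplified to \<open>x\<close>: the
    pointwise identity demanded by \<open>transfer\<close> ranges over all z, and the two differ for
    negative x.\<close>
  have v2: "has_bochner_integral ?P (\<lambda>z. k * ((sqrt (fst z))\<^sup>2 * (snd z)\<^sup>2)) (k * (\<nu> * \<gamma>1))" for k
    using pair[of 1 "\<lambda>x. (sqrt x)\<^sup>2" k 2, unfolded \<Gamma>(1)] by (simp add: N)
  have r1: "has_bochner_integral ?P (\<lambda>z. c * fst z + sqrt d * (sqrt (fst z) * snd z)) (c * (\<nu> * \<gamma>1) + 0)"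
    by (intro has_bochner_integral_add s1 v1)
  have r2: "has_bochner_integral ?P (\<lambda>z. c\<^sup>2 * (fst z)\<^sup>2 + 2 * c * sqrt d * (fst z * sqrt (fst z) * snd z)
      + d * ((sqrt (fst z))\<^sup>2 * (snd z)\<^sup>2)) (c\<^sup>2 * (\<nu> * (\<nu> + 2) * \<gamma>1\<^sup>2) + 0 + d * (\<nu> * \<gamma>1))"
    by (intro has_bochner_integral_add s2 sv v2)
  have s: "integrable M (\<lambda>\<omega>. fst (\<Theta> \<omega>)) \<and> expectation (\<lambda>\<omega>. fst (\<Theta> \<omega>)) = \<nu> * \<gamma>1"
    using transfer[OF s1[of 1], of fst] by auto
  have ss: "integrable M (\<lambda>\<omega>. (fst (\<Theta> \<omega>))\<^sup>2) \<and> expectation (\<lambda>\<omega>. (fst (\<Theta> \<omega>))\<^sup>2) = \<nu> * (\<nu> + 2) * \<gamma>1\<^sup>2"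
    using transfer[OF s2[of 1], of "\<lambda>p. (fst p)\<^sup>2"] by auto
  have r: "integrable M (\<lambda>\<omega>. snd (snd (\<Theta> \<omega>))) \<and> expectation (\<lambda>\<omega>. snd (snd (\<Theta> \<omega>))) = \<nu> * \<gamma>3"
    using transfer[OF r1, of snd] \<gamma> by (auto simp: c_def real_sqrt_mult)
  have rr: "integrable M (\<lambda>\<omega>. (snd (snd (\<Theta> \<omega>)))\<^sup>2) \<and>
      expectation (\<lambda>\<omega>. (snd (snd (\<Theta> \<omega>)))\<^sup>2) = c\<^sup>2 * (\<nu> * (\<nu> + 2) * \<gamma>1\<^sup>2) + 0 + d * (\<nu> * \<gamma>1)"
  proof (rule transfer[OF r2, of "\<lambda>p. (snd p)\<^sup>2", unfolded snd_conv])
    have d2: "d = (sqrt d)\<^sup>2" using d by simp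
    show "(snd (?T z))\<^sup>2 = c\<^sup>2 * (fst z)\<^sup>2 + 2 * c * sqrt d * (fst z * sqrt (fst z) * snd z)
      + d * ((sqrt (fst z))\<^sup>2 * (snd z)\<^sup>2)" for z
      by (subst (3) d2) (simp add: case_prod_beta real_sqrt_mult power2_eq_square algebra_simps)
  qed measurable
  show "integrable M (\<lambda>\<omega>. (fst (\<Theta> \<omega>))\<^sup>2)" "expectation (\<lambda>\<omega>. fst (\<Theta> \<omega>)) = \<nu> * \<gamma>1"
    "integrable M (\<lambda>\<omega>. (snd (snd (\<Theta> \<omega>)))\<^sup>2)" "expectation (\<lambda>\<omega>. snd (snd (\<Theta> \<omega>))) = \<nu> * \<gamma>3"
    using s ss r rr by auto
  show "variance (\<lambda>\<omega>. fst (\<Theta> \<omega>)) = \<nu> * (2 * \<gamma>1\<^sup>2)"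
    using variance_eq[of "\<lambda>\<omega>. fst (\<Theta> \<omega>)"] s ss by (simp add: power2_eq_square algebra_simps)
  show "variance (\<lambda>\<omega>. snd (snd (\<Theta> \<omega>))) = \<nu> * (\<gamma>1 * \<gamma>2 + \<gamma>3\<^sup>2)"
  proof -
    have "variance (\<lambda>\<omega>. snd (snd (\<Theta> \<omega>)))
        = c\<^sup>2 * (\<nu> * (\<nu> + 2) * \<gamma>1\<^sup>2) + 0 + d * (\<nu> * \<gamma>1) - (\<nu> * \<gamma>3)\<^sup>2"
      using variance_eq[of "\<lambda>\<omega>. snd (snd (\<Theta> \<omega>))"] r rr by simp
    \<comment> \<open>The first and last terms combine to
      \<open>2 * \<nu> * \<gamma>3\<^sup>2\<close>, and \<open>d * (\<nu> * \<gamma>1)\<close> is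
      \<open>\<nu> * (\<gamma>1 * \<gamma>2 - \<gamma>3\<^sup>2)\<close>.\<close>
    also have "\<dots> = \<nu> * (\<gamma>1 * \<gamma>2 + \<gamma>3\<^sup>2)"
      using \<gamma> by (simp add: c_def d_def field_simps power2_eq_square)
    finally show ?thesis .
  qed
qed

section \<open>Rescaled sample means and the limits of all six estimators\<close>

text \<open>Mean and variance are both proportional to \<nu>. Division by \<open>sqrt \<nu>\<close>
  turns the variance into \<open>v\<close>, which explains the normalization
  \<open>sqrt (\<nu> * n)\<close>.\<close>

lemma (in prob_space) rescaled_mean_central_limit:
  fixes X :: "nat \<Rightarrow> 'a \<Rightarrow> real"
  assumes indep: "indep_vars (\<lambda>_. borel) X UNIV"
    and dist: "\<And>i. distr M borel (X i) = \<mu>"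
    and sq: "\<And>i. integrable M (\<lambda>\<omega>. (X i \<omega>)\<^sup>2)"
    and mean: "\<And>i. expectation (X i) = \<nu> * m"
    and var: "\<And>i. variance (X i) = \<nu> * v"
    and pos: "\<nu> > 0" "v > 0"
  shows "converges_in_distribution M (\<lambda>n \<omega>. sqrt (\<nu> * real n) * (1 / (real n * \<nu>) * (\<Sum>i<n. X i \<omega>) - m))
    (normal_distribution 0 v)"
proof -
  have X: "random_variable borel (X i)" for i
    using indep unfolding indep_vars_def2 by simp
  have eq: "sqrt (\<nu> * real n) * (1 / (real n * \<nu>) * (\<Sum>i<n. X i \<omega>) - m)
      = (\<Sum>i<n. X i \<omega> / sqrt \<nu> - sqrt \<nu> * m) / sqrt n" for n \<omega>
  proof (cases "n = 0")
    case False
    have "(\<Sum>i<n. X i \<omega> / sqrt \<nu> - sqrt \<nu> * m) = (\<Sum>i<n. X i \<omega>) / sqrt \<nu> - n * (sqrt \<nu> * m)"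
      by (simp add: sum_subtractf sum_divide_distrib)
    \<comment> \<open>With p and q for \<open>sqrt \<nu>\<close> and \<open>sqrt n\<close> the
      identity is purely rational.\<close>
    moreover have "p * q * (1 / ((q * q) * (p * p)) * S - m) = (S / p - (q * q) * (p * m)) / q"
      if "p > 0" "q > 0" for p q S
      using that by (simp add: field_simps)
    from this[of "sqrt \<nu>" "sqrt n" "\<Sum>i<n. X i \<omega>"]
    have "sqrt (\<nu> * real n) * (1 / (real n * \<nu>) * (\<Sum>i<n. X i \<omega>) - m)
        = ((\<Sum>i<n. X i \<omega>) / sqrt \<nu> - n * (sqrt \<nu> * m)) / sqrt n"
      using pos False by (simp add: real_sqrt_mult)
    ultimately show ?thesis by simp
  qed simp
  show ?thesis
    unfolding eq
  proof (rule central_limit_theorem_normal_distribution)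
    show "indep_vars (\<lambda>_. borel) (\<lambda>i \<omega>. X i \<omega> / sqrt \<nu>) UNIV"
      by (rule indep_vars_compose2[OF indep]) auto
    show mean': "expectation (\<lambda>\<omega>. X i \<omega> / sqrt \<nu>) = sqrt \<nu> * m" for i
      using mean[of i] pos by (simp add: field_simps)
    show "integrable M (\<lambda>\<omega>. (X i \<omega> / sqrt \<nu>)\<^sup>2)" for i
      using sq[of i] by (simp add: power_divide)
    have "(X i \<omega> / sqrt \<nu> - sqrt \<nu> * m)\<^sup>2 = (X i \<omega> - \<nu> * m)\<^sup>2 / \<nu>" for i \<omega>
    proof -
      have "X i \<omega> / sqrt \<nu> - sqrt \<nu> * m = (X i \<omega> - \<nu> * m) / sqrt \<nu>"
        using pos by (simp add: field_simps)
      then show ?thesis using pos by (simp add: power_divide)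
    qed
    then show "variance (\<lambda>\<omega>. X i \<omega> / sqrt \<nu>) = v" for i
      unfolding mean' using var[of i] mean[of i] pos by simp
    show "distr M borel (\<lambda>\<omega>. X i \<omega> / sqrt \<nu>) = distr \<mu> borel (\<lambda>x. x / sqrt \<nu>)" for i
      unfolding dist[of i, symmetric] by (subst distr_distr) (auto simp: comp_def X)
  qed (rule pos)
qed

theorem theorem2:
  fixes M :: "'a measure"
    and \<Theta>1 :: "nat \<Rightarrow> 'a \<Rightarrow> real \<times> real"
    and \<Theta>2 :: "nat \<Rightarrow> 'a \<Rightarrow> real \<times> real \<times> real"
    and \<mu>x \<mu>y \<sigma>x \<sigma>y \<rho> \<sigma>xy \<nu> \<gamma>1 \<gamma>2 \<gamma>3 :: real
  assumes "prob_space M"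
    and "\<sigma>x > 0" and "\<sigma>y > 0" and "\<bar>\<rho>\<bar> < 1"
    and "\<gamma>1 > 0" and "\<gamma>2 > 0" and "\<gamma>1 * \<gamma>2 > \<gamma>3\<^sup>2"
    and "\<nu> > 2"
    and "\<sigma>xy = \<rho> * \<sigma>x * \<sigma>y"
    and "prob_space.indep_vars M (\<lambda>_. borel) (\<lambda>i \<omega>. (\<Theta>1 i \<omega>, \<Theta>2 i \<omega>)) UNIV"
    and "\<And>i. indep_rv M borel (\<Theta>1 i) borel (\<Theta>2 i)"
    and "\<And>i. distributed M lborel (\<Theta>1 i) (\<lambda>z. ennreal (bivariate_normal_density \<mu>x \<mu>y \<sigma>x \<sigma>y \<rho> z))"
    and "\<And>i. distributed M lborel (\<Theta>2 i) (\<lambda>z. ennreal (bivariate_wishart_density \<nu> \<gamma>1 \<gamma>2 \<gamma>3 z))"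
  shows
    "(converges_in_distribution M (\<lambda>n \<omega>. sqrt (real n) * (sigma_x_sq_hat \<Theta>1 n \<omega> - \<sigma>x\<^sup>2))
        (normal_distribution 0 (2 * \<sigma>x ^ 4)) \<and>
      converges_in_distribution M (\<lambda>n \<omega>. sqrt (real n) * (sigma_y_sq_hat \<Theta>1 n \<omega> - \<sigma>y\<^sup>2))
        (normal_distribution 0 (2 * \<sigma>y ^ 4)) \<and>
      converges_in_distribution M (\<lambda>n \<omega>. sqrt (real n) * (sigma_xy_hat \<Theta>1 n \<omega> - \<sigma>xy))
        (normal_distribution 0 ((1 + \<rho>\<^sup>2) * \<sigma>x\<^sup>2 * \<sigma>y\<^sup>2))) \<and>
     (converges_in_distribution M (\<lambda>n \<omega>. sqrt (\<nu> * real n) * (gamma1_hat \<nu> \<Theta>2 n \<omega> - \<gamma>1))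
        (normal_distribution 0 (2 * \<gamma>1\<^sup>2)) \<and>
      converges_in_distribution M (\<lambda>n \<omega>. sqrt (\<nu> * real n) * (gamma2_hat \<nu> \<Theta>2 n \<omega> - \<gamma>2))
        (normal_distribution 0 (2 * \<gamma>2\<^sup>2)) \<and>
      converges_in_distribution M (\<lambda>n \<omega>. sqrt (\<nu> * real n) * (gamma3_hat \<nu> \<Theta>2 n \<omega> - \<gamma>3))
        (normal_distribution 0 (\<gamma>1 * \<gamma>2 + \<gamma>3\<^sup>2)))"
proof -
  interpret prob_space M by fact
  have \<sigma>: "\<sigma>x > 0" "\<sigma>y > 0" "\<bar>\<rho>\<bar> < 1" and \<gamma>: "\<gamma>1 > 0" "\<gamma>2 > 0" "\<gamma>1 * \<gamma>2 > \<gamma>3\<^sup>2" and \<nu>: "\<nu> > 2"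
    and \<sigma>xy: "\<sigma>xy = \<rho> * \<sigma>x * \<sigma>y"
    and indep: "indep_vars (\<lambda>_. borel) (\<lambda>i \<omega>. (\<Theta>1 i \<omega>, \<Theta>2 i \<omega>)) UNIV"
    and D1: "\<And>i. distributed M lborel (\<Theta>1 i) (\<lambda>z. ennreal (bivariate_normal_density \<mu>x \<mu>y \<sigma>x \<sigma>y \<rho> z))"
    and D2: "\<And>i. distributed M lborel (\<Theta>2 i) (\<lambda>z. ennreal (bivariate_wishart_density \<nu> \<gamma>1 \<gamma>2 \<gamma>3 z))"
    by fact+
  let ?s = "sqrt (1 - \<rho>\<^sup>2)"
  have \<rho>: "\<rho>\<^sup>2 < 1" using \<sigma>(3) by (simp add: abs_square_less_1)
  \<comment> \<open>Maps from pairs to pairs are allowed so as to cover the duplicated pairs (x, x)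
    and (y, y).\<close>
  have indep1: "indep_vars (\<lambda>_. borel) (\<lambda>i \<omega>. f (\<Theta>1 i \<omega>)) UNIV" if "f \<in> borel \<rightarrow>\<^sub>M borel"
    for f :: "real \<times> real \<Rightarrow> real \<times> real"
    using indep_vars_compose2[OF indep, of "\<lambda>_ z. f (fst z)" "\<lambda>_. borel"] that
    by (simp add: measurable_compose[OF borel_measurable_continuous_onI[OF continuous_on_fst[OF continuous_on_id]] that])
  have indep2: "indep_vars (\<lambda>_. borel) (\<lambda>i \<omega>. f (\<Theta>2 i \<omega>)) UNIV" if "f \<in> borel_measurable borel"
    for f :: "real \<times> real \<times> real \<Rightarrow> real"
    using indep_vars_compose2[OF indep, of "\<lambda>_ z. f (snd z)" "\<lambda>_. borel"] that
    by (simp add: measurable_compose[OF borel_measurable_continuous_onI[OF continuous_on_snd[OF continuous_on_id]] that])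
  have \<Theta>1: "\<Theta>1 i \<in> M \<rightarrow>\<^sub>M borel" and \<Theta>2: "\<Theta>2 i \<in> M \<rightarrow>\<^sub>M borel" for i
    using distributed_measurable[OF D1] distributed_measurable[OF D2] by simp_all

  let ?P = "std_normal_distribution \<Otimes>\<^sub>M std_normal_distribution"
  let ?T = "\<lambda>z. (\<mu>x + \<sigma>x * fst z, \<mu>y + (\<sigma>y * \<rho> * fst z + \<sigma>y * ?s * snd z))"
  have T: "?T \<in> ?P \<rightarrow>\<^sub>M borel"
    by (simp flip: borel_prod)
  have "bivariate_normal_density \<mu>x \<mu>y \<sigma>x \<sigma>y \<rho> \<in> borel_measurable borel"
    by (simp add: bivariate_normal_density_def flip: borel_prod)
  then have law1: "distr M borel (\<Theta>1 i) = distr ?P borel ?T" for i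
    using distributed_distr_eq_density[OF D1[of i]] bivariate_normal_eq_distr[OF \<sigma>]
    by (simp add: case_prod_beta cong: distr_cong)
  have dist1: "distr M borel (\<lambda>\<omega>. f (\<Theta>1 i \<omega>)) = distr ?P borel (\<lambda>z. f (?T z))" if "f \<in> borel \<rightarrow>\<^sub>M borel"
    for f :: "real \<times> real \<Rightarrow> real \<times> real" and i
    using distr_distr[OF that \<Theta>1[of i]] distr_distr[OF that T] law1[of i] by (simp add: comp_def)
  \<comment> \<open>The central limit theorem asks only for some common law; that of index 0 is
    taken.\<close>
  have dist2: "distr M borel (\<lambda>\<omega>. f (\<Theta>2 i \<omega>)) = distr M borel (\<lambda>\<omega>. f (\<Theta>2 0 \<omega>))" if "f \<in> borel_measurable borel"
    for f :: "real \<times> real \<times> real \<Rightarrow> real" and i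
  proof -
    have "distr M borel (\<lambda>\<omega>. f (\<Theta>2 j \<omega>)) = distr (distr M lborel (\<Theta>2 j)) borel f" for j
      by (subst distr_distr) (use that distributed_measurable[OF D2] in \<open>auto simp: comp_def\<close>)
    then show ?thesis
      by (simp add: distributed_distr_eq_density[OF D2])
  qed

  have xx: "(\<lambda>p. (fst p, fst p)) \<in> borel \<rightarrow>\<^sub>M (borel :: (real \<times> real) measure)"
    and yy: "(\<lambda>p. (snd p, snd p)) \<in> borel \<rightarrow>\<^sub>M (borel :: (real \<times> real) measure)"
    by (auto intro!: borel_measurable_continuous_onI continuous_intros)
  have "converges_in_distribution M (\<lambda>n \<omega>. sqrt (real n) * (sigma_x_sq_hat \<Theta>1 n \<omega> - \<sigma>x\<^sup>2))
        (normal_distribution 0 (2 * \<sigma>x ^ 4))"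
  proof -
    have v: "(\<sigma>x\<^sup>2 + 0\<^sup>2) * (\<sigma>x\<^sup>2 + 0\<^sup>2) + (\<sigma>x * \<sigma>x + 0 * 0)\<^sup>2 = 2 * \<sigma>x ^ 4"
      by (simp add: power2_eq_square power4_eq_xxxx)
    have c: "\<sigma>x * \<sigma>x + 0 * 0 = \<sigma>x\<^sup>2"
      by (simp add: power2_eq_square)
    show ?thesis
      using gaussian_sample_covariance_central_limit[OF indep1[OF xx], of \<mu>x \<sigma>x 0 \<mu>x \<sigma>x 0,
          unfolded v, unfolded c] dist1[OF xx] \<sigma>
      by (simp add: sigma_x_sq_hat_def mu_x_hat_def power2_eq_square[of "_ - _"])
  qed
  moreover have "converges_in_distribution M (\<lambda>n \<omega>. sqrt (real n) * (sigma_y_sq_hat \<Theta>1 n \<omega> - \<sigma>y\<^sup>2))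
        (normal_distribution 0 (2 * \<sigma>y ^ 4))"
  proof -
    have "\<sigma>y * \<rho> * (\<sigma>y * \<rho>) + \<sigma>y * ?s * (\<sigma>y * ?s) = \<sigma>y\<^sup>2 * (\<rho>\<^sup>2 + ?s\<^sup>2)"
      by (simp add: power2_eq_square algebra_simps)
    then have c: "\<sigma>y * \<rho> * (\<sigma>y * \<rho>) + \<sigma>y * ?s * (\<sigma>y * ?s) = \<sigma>y\<^sup>2"
      using \<rho> by simp
    then have c': "(\<sigma>y * \<rho>)\<^sup>2 + (\<sigma>y * ?s)\<^sup>2 = \<sigma>y\<^sup>2"
      by (simp add: power2_eq_square)
    have v: "\<sigma>y\<^sup>2 * \<sigma>y\<^sup>2 + (\<sigma>y\<^sup>2)\<^sup>2 = 2 * \<sigma>y ^ 4"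
      by (simp add: power2_eq_square power4_eq_xxxx)
    show ?thesis
      using gaussian_sample_covariance_central_limit[OF indep1[OF yy],
          of \<mu>y "\<sigma>y * \<rho>" "\<sigma>y * ?s" \<mu>y "\<sigma>y * \<rho>" "\<sigma>y * ?s", unfolded c c' v] dist1[OF yy] \<sigma>
      by (simp add: sigma_y_sq_hat_def mu_y_hat_def power2_eq_square[of "_ - _"])
  qed
  moreover have "converges_in_distribution M (\<lambda>n \<omega>. sqrt (real n) * (sigma_xy_hat \<Theta>1 n \<omega> - \<sigma>xy))
        (normal_distribution 0 ((1 + \<rho>\<^sup>2) * \<sigma>x\<^sup>2 * \<sigma>y\<^sup>2))"
  proof -
    \<comment> \<open>\<open>?s\<^sup>2\<close> stays symbolic:
      \<open>\<rho>\<^sup>2 + ?s\<^sup>2 = 1\<close> comes from the product of variances, the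
      further \<open>\<rho>\<^sup>2\<close> from the squared covariance.\<close>
    have "(\<sigma>x\<^sup>2 + 0\<^sup>2) * ((\<sigma>y * \<rho>)\<^sup>2 + (\<sigma>y * ?s)\<^sup>2) + (\<sigma>x * (\<sigma>y * \<rho>) + 0 * (\<sigma>y * ?s))\<^sup>2
        = (\<rho>\<^sup>2 + ?s\<^sup>2 + \<rho>\<^sup>2) * \<sigma>x\<^sup>2 * \<sigma>y\<^sup>2"
      by (simp add: power_mult_distrib algebra_simps del: real_sqrt_pow2 real_sqrt_pow2_iff)
    then have v: "(\<sigma>x\<^sup>2 + 0\<^sup>2) * ((\<sigma>y * \<rho>)\<^sup>2 + (\<sigma>y * ?s)\<^sup>2) + (\<sigma>x * (\<sigma>y * \<rho>) + 0 * (\<sigma>y * ?s))\<^sup>2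
        = (1 + \<rho>\<^sup>2) * \<sigma>x\<^sup>2 * \<sigma>y\<^sup>2"
      using \<rho> by simp
    have c: "\<sigma>x * (\<sigma>y * \<rho>) + 0 * (\<sigma>y * ?s) = \<sigma>xy"
      by (simp add: \<sigma>xy)
    have pos: "(1 + \<rho>\<^sup>2) * \<sigma>x\<^sup>2 * \<sigma>y\<^sup>2 > 0"
      using \<sigma> by (intro mult_pos_pos add_pos_nonneg) auto
    show ?thesis
      using gaussian_sample_covariance_central_limit[of "\<lambda>i \<omega>. fst (\<Theta>1 i \<omega>)" "\<lambda>i \<omega>. snd (\<Theta>1 i \<omega>)"
          \<mu>x \<sigma>x 0 \<mu>y "\<sigma>y * \<rho>" "\<sigma>y * ?s", unfolded v, unfolded c] indep1[of "\<lambda>p. p"] dist1[of "\<lambda>p. p"] pos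
      by (simp add: sigma_xy_hat_def mu_x_hat_def mu_y_hat_def)
  qed
  moreover have "converges_in_distribution M (\<lambda>n \<omega>. sqrt (\<nu> * real n) * (gamma1_hat \<nu> \<Theta>2 n \<omega> - \<gamma>1))
        (normal_distribution 0 (2 * \<gamma>1\<^sup>2))"
  proof -
    have f: "fst \<in> borel_measurable (borel :: (real \<times> real \<times> real) measure)"
      by (simp flip: borel_prod)
    show ?thesis
      unfolding gamma1_hat_def
      by (rule rescaled_mean_central_limit[OF indep2[OF f] dist2[OF f]])
        (use bivariate_wishart_moments[OF \<gamma>(1,3) \<nu> D2] \<gamma> \<nu> in auto)
  qed
  moreover have "converges_in_distribution M (\<lambda>n \<omega>. sqrt (\<nu> * real n) * (gamma2_hat \<nu> \<Theta>2 n \<omega> - \<gamma>2))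
        (normal_distribution 0 (2 * \<gamma>2\<^sup>2))"
  proof -
    have f: "(\<lambda>z. fst (snd z)) \<in> borel_measurable (borel :: (real \<times> real \<times> real) measure)"
      by (simp flip: borel_prod)
    \<comment> \<open>The moments of t are those of the first coordinate of the swapped vector,
      whose parameters are \<gamma>2, \<gamma>1, \<gamma>3.\<close>
    have "\<gamma>2 * \<gamma>1 > \<gamma>3\<^sup>2" using \<gamma> by (simp add: mult.commute)
    then show ?thesis
      unfolding gamma2_hat_def
      by (intro rescaled_mean_central_limit[OF indep2[OF f] dist2[OF f]])
        (use bivariate_wishart_moments(1-3)[OF \<gamma>(2) _ \<nu> distributed_bivariate_wishart_swap[OF D2]] \<gamma> \<nu>
          in \<open>auto simp: case_prod_beta\<close>)
  qed
  moreover have "converges_in_distribution M (\<lambda>n \<omega>. sqrt (\<nu> * real n) * (gamma3_hat \<nu> \<Theta>2 n \<omega> - \<gamma>3))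
        (normal_distribution 0 (\<gamma>1 * \<gamma>2 + \<gamma>3\<^sup>2))"
  proof -
    have f: "(\<lambda>z. snd (snd z)) \<in> borel_measurable (borel :: (real \<times> real \<times> real) measure)"
      by (simp flip: borel_prod)
    show ?thesis
      unfolding gamma3_hat_def
      by (rule rescaled_mean_central_limit[OF indep2[OF f] dist2[OF f]])
        (use bivariate_wishart_moments[OF \<gamma>(1,3) \<nu> D2] \<gamma> \<nu> in \<open>auto intro: add_pos_nonneg\<close>)
  qed
  ultimately show ?thesis by blast
qed

end
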